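(* Let $\mathbb{F}$ be a field with $\mathrm{char}(\mathbb{F}) = p > 0$, and let $0 \neq h \in \mathbb{F}[x]$. Then all irreducible $\mathsf{A}_h$-modules are finite dimensional over $\mathbb{F}$.
   Context: For a field $\mathbb{F}$ and $h \in \mathbb{F}[x]$, $\mathsf{A}_h$ denotes the unital associative $\mathbb{F}$-algebra with generators $x,y$ and defining relation $yx = xy + h$. Throughout, $h \neq 0$. Modules are left modules. *)

theory Defs
  imports
    "HOL-Library.Poly_Mapping"
    "HOL-Computational_Algebra.Polynomial"
    "HOL-Algebra.QuotRing"
    "HOL-Algebra.Module"
    "Jordan_Normal_Form.VS_Connect"
begin

section \<open>Free associative algebras\<close>

text \<open>The monoid of words is written additively, since the convolution product of
  \<^typ>\<open>'m \<Rightarrow>\<^sub>0 'k\<close> is the monoid algebra of an additively written (not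
  necessarily commutative) monoid.\<close>

datatype 'x free_monoid = Word (letters: "'x list")

instantiation free_monoid :: (type) monoid_add
begin

definition zero_free_monoid :: "'a free_monoid"
  where "0 = Word []"

definition plus_free_monoid :: "'a free_monoid \<Rightarrow> 'a free_monoid \<Rightarrow> 'a free_monoid"
  where "u + v = Word (letters u @ letters v)"

instance
  by standard (simp_all add: zero_free_monoid_def plus_free_monoid_def)

end

type_synonym ('x, 'k) free_algebra = "'x free_monoid \<Rightarrow>\<^sub>0 'k"

definition gen :: "'x \<Rightarrow> ('x, 'k::field) free_algebra"
  where "gen x = Poly_Mapping.single (Word [x]) 1"

definition scalar :: "'k \<Rightarrow> ('x, 'k::field) free_algebra"
  where "scalar c = Poly_Mapping.single 0 c"

definition poly_at :: "'k poly \<Rightarrow> ('x, 'k::field) free_algebra \<Rightarrow> ('x, 'k) free_algebra"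
  where "poly_at f a = (\<Sum>i\<le>Polynomial.degree f. scalar (Polynomial.coeff f i) * a ^ i)"


section \<open>The algebra with generators x, y and relation yx = xy + h(x)\<close>

datatype xy = X | Y

definition A_relator :: "'k poly \<Rightarrow> (xy, 'k::field) free_algebra"
  where "A_relator h = gen Y * gen X - (gen X * gen Y + poly_at h (gen X))"

definition A_ideal :: "'k poly \<Rightarrow> (xy, 'k::field) free_algebra set"
  where "A_ideal h = Idl\<^bsub>class_ring\<^esub> {A_relator h}"

definition A_alg :: "'k poly \<Rightarrow> (xy, 'k::field) free_algebra set ring"
  where "A_alg h = class_ring Quot A_ideal h"

definition A_proj :: "'k poly \<Rightarrow> (xy, 'k::field) free_algebra \<Rightarrow> (xy, 'k) free_algebra set"
  where "A_proj h a = A_ideal h +>\<^bsub>class_ring\<^esub> a"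

definition A_scalar :: "'k poly \<Rightarrow> 'k \<Rightarrow> (xy, 'k::field) free_algebra set"
  where "A_scalar h c = A_proj h (scalar c)"


section \<open>Left modules over not necessarily commutative rings\<close>

text \<open>The locale \<^locale>\<open>Module.module\<close> of the library presupposes a commutative ring; the
  axioms below are the same, over an arbitrary ring.\<close>

locale left_module = R?: ring R + M?: abelian_group M
  for R :: "('a, 'c) ring_scheme" (structure) and M :: "('a, 'v) module" (structure) +
  assumes smult_closed [simp, intro]:
      "\<lbrakk>a \<in> carrier R; x \<in> carrier M\<rbrakk> \<Longrightarrow> a \<odot>\<^bsub>M\<^esub> x \<in> carrier M"
    and smult_l_distr:
      "\<lbrakk>a \<in> carrier R; b \<in> carrier R; x \<in> carrier M\<rbrakk> \<Longrightarrow>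
        (a \<oplus>\<^bsub>R\<^esub> b) \<odot>\<^bsub>M\<^esub> x = a \<odot>\<^bsub>M\<^esub> x \<oplus>\<^bsub>M\<^esub> b \<odot>\<^bsub>M\<^esub> x"
    and smult_r_distr:
      "\<lbrakk>a \<in> carrier R; x \<in> carrier M; y \<in> carrier M\<rbrakk> \<Longrightarrow>
        a \<odot>\<^bsub>M\<^esub> (x \<oplus>\<^bsub>M\<^esub> y) = a \<odot>\<^bsub>M\<^esub> x \<oplus>\<^bsub>M\<^esub> a \<odot>\<^bsub>M\<^esub> y"
    and smult_assoc:
      "\<lbrakk>a \<in> carrier R; b \<in> carrier R; x \<in> carrier M\<rbrakk> \<Longrightarrow>
        (a \<otimes>\<^bsub>R\<^esub> b) \<odot>\<^bsub>M\<^esub> x = a \<odot>\<^bsub>M\<^esub> (b \<odot>\<^bsub>M\<^esub> x)"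
    and smult_one [simp]:
      "x \<in> carrier M \<Longrightarrow> \<one>\<^bsub>R\<^esub> \<odot>\<^bsub>M\<^esub> x = x"

text \<open>\<^locale>\<open>Module.submodule\<close> only asks for an additive subgroup closed under the action, without
  any assumption on the ring. It has to be qualified, because the vector space library
  has a locale of the same name that includes commutativity of the ring.\<close>

definition irreducible_module :: "('a, 'c) ring_scheme \<Rightarrow> ('a, 'v) module \<Rightarrow> bool"
  where "irreducible_module R M \<longleftrightarrow>
    left_module R M \<and> carrier M \<noteq> {\<zero>\<^bsub>M\<^esub>} \<and>
    (\<forall>N. Module.submodule N R M \<longrightarrow> N = {\<zero>\<^bsub>M\<^esub>} \<or> N = carrier M)"

definition restrict_scalars :: "('k \<Rightarrow> 'a) \<Rightarrow> ('a, 'v) module \<Rightarrow> ('k, 'v) module"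
  where "restrict_scalars \<phi> M =
    \<lparr>carrier = carrier M, mult = mult M, one = one M, zero = zero M, add = add M,
     smult = (\<lambda>c v. \<phi> c \<odot>\<^bsub>M\<^esub> v)\<rparr>"

text \<open>The vector space over the ground field underlying a module over \<^term>\<open>A_alg h\<close>.\<close>

definition A_vs :: "'k poly \<Rightarrow> ((xy, 'k::field) free_algebra set, 'v) module \<Rightarrow> ('k, 'v) module"
  where "A_vs h M = restrict_scalars (A_scalar h) M"


section \<open>Basic facts\<close>

lemma ideal_A_ideal: "ideal (A_ideal h) class_ring"
  unfolding A_ideal_def
  by (rule ring.genideal_ideal) (use class_ring.ring_axioms in auto)

lemma ring_A_alg: "ring (A_alg h)"
  unfolding A_alg_def by (rule ideal.quotient_is_ring[OF ideal_A_ideal])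

lemma A_proj_hom: "A_proj h \<in> Ring.ring_hom class_ring (A_alg h)"
  using ideal.rcos_ring_hom[OF ideal_A_ideal, of h]
  unfolding A_alg_def A_proj_def[abs_def] .

lemma scalar_hom: "scalar \<in> Ring.ring_hom class_ring class_ring"
  by (rule ring_hom_memI) (simp_all add: scalar_def mult_single single_add)

lemma A_scalar_hom: "A_scalar h \<in> Ring.ring_hom class_ring (A_alg h)"
proof -
  have "A_scalar h = A_proj h \<circ> scalar"
    by (simp add: fun_eq_iff A_scalar_def)
  then show ?thesis
    using ring_hom_trans[OF scalar_hom A_proj_hom] by simp
qed

lemma A_relation:
  "A_proj h (gen Y) \<otimes>\<^bsub>A_alg h\<^esub> A_proj h (gen X) =
   (A_proj h (gen X) \<otimes>\<^bsub>A_alg h\<^esub> A_proj h (gen Y)) \<oplus>\<^bsub>A_alg h\<^esub> A_proj h (poly_at h (gen X))"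
proof -
  interpret I: ideal "A_ideal h" class_ring by (rule ideal_A_ideal)
  let ?b = "gen X * gen Y + poly_at h (gen X) :: (xy, 'a) free_algebra"
  have "A_relator h \<in> A_ideal h"
    using ring.genideal_self[OF class_ring.ring_axioms, of "{A_relator h}"]
    by (simp add: A_ideal_def)
  moreover have "gen Y * gen X = A_relator h + ?b"
    by (simp add: A_relator_def)
  ultimately have "gen Y * gen X \<in> A_ideal h +>\<^bsub>class_ring\<^esub> ?b"
    by (auto simp: a_r_coset_def')
  then have "A_ideal h +>\<^bsub>class_ring\<^esub> ?b = A_ideal h +>\<^bsub>class_ring\<^esub> (gen Y * gen X)"
    by (intro I.a_repr_independence') auto
  then have "A_proj h (gen Y * gen X) = A_proj h ?b"
    by (simp add: A_proj_def)
  then show ?thesis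
    using ring_hom_mult[OF A_proj_hom, of "gen Y" "gen X" h]
      ring_hom_mult[OF A_proj_hom, of "gen X" "gen Y" h]
      ring_hom_add[OF A_proj_hom, of "gen X * gen Y" "poly_at h (gen X)" h]
    by simp
qed

lemma vectorspace_A_vs:
  fixes h :: "'k::field poly"
  assumes "left_module (A_alg h) M"
  shows "vectorspace class_ring (A_vs h M)"
proof -
  interpret M: left_module "A_alg h" M by (rule assms)
  have cl: "A_scalar h c \<in> carrier (A_alg h)" for c
    using ring_hom_closed[OF A_scalar_hom, of c h] by simp
  have ab: "abelian_group (A_vs h M)"
    by (rule abelian_groupI)
      (auto simp: A_vs_def restrict_scalars_def M.M.a_assoc M.M.a_comm M.M.a_lcomm
        intro: M.M.a_closed bexI[OF _ M.M.a_inv_closed] M.M.l_neg)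
  have "Module.module (class_ring :: 'k ring) (A_vs h M)"
    using ring_hom_add[OF A_scalar_hom, of _ _ h] ring_hom_mult[OF A_scalar_hom, of _ _ h]
      ring_hom_one[OF A_scalar_hom, of h] ab
    by (intro moduleI class_cring.cring_axioms)
      (auto simp: A_vs_def restrict_scalars_def cl M.smult_l_distr M.smult_r_distr M.smult_assoc)
  then show ?thesis
    unfolding vectorspace_def using class_field.field_axioms by blast
qed

end

theory Submission
  imports Defs
begin

text \<open>The algebra acts on the commutative polynomial ring \<open>T = F[x][y]\<close>, with \<open>x\<close> acting by multiplication
  and \<open>y\<close> by \<open>t \<mapsto> y t + \<delta> t\<close>, where \<open>\<delta> = h d/dx\<close> on coefficients. This is the regular module, written in
  the basis \<open>x^i y^j\<close>, so every irreducible module is \<open>T / J\<close> for a maximal invariant subspace \<open>J\<close>.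
  In characteristic \<open>p\<close> the power \<open>\<delta>^p\<close> is again a derivation, hence \<open>\<delta>^p = r \<delta>\<close> for a polynomial \<open>r\<close> with
  \<open>\<delta> r = 0\<close>. Therefore \<open>u = x^p\<close> and \<open>z = y^p - r y\<close> are central; they act on \<open>T\<close> by ordinary multiplication, and
  \<open>T\<close> is generated by the \<open>x^i y^j\<close> with \<open>i, j < p\<close> over \<open>C = F[u, z]\<close>. By Schur's lemma every element of
  \<open>C\<close> annihilates \<open>T / J\<close> or acts on it surjectively. Nakayama's lemma and the argument of Zariski's lemma
  then show that \<open>u\<close> and \<open>z\<close> are algebraic modulo \<open>J\<close>, so \<open>T / J\<close> is finite dimensional.\<close>

section \<open>Nakayama's lemma modulo a subgroup\<close>

text \<open>Spans are formed modulo \<open>J\<close>, as congruences in the ring itself, so that the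
  \<open>C\<close>-module of cosets never has to be constructed.\<close>

definition span_mod :: "'a::comm_ring_1 set \<Rightarrow> 'a set \<Rightarrow> 'a set \<Rightarrow> 'a set"
  where "span_mod C J G = {t. \<exists>d. (\<forall>g\<in>G. d g \<in> C) \<and> t - (\<Sum>g\<in>G. d g * g) \<in> J}"

text \<open>\<open>J\<close> is a \<open>C\<close>-submodule and not an ideal: the intended
  \<open>J\<close> is stable under \<open>y_op\<close>, but in general not under multiplication by
  \<open>y\<close>.\<close>

locale subring_submodule =
  fixes C J :: "'a::comm_ring_1 set"
  assumes one_in [simp]: "1 \<in> C"
    and add_in: "a \<in> C \<Longrightarrow> b \<in> C \<Longrightarrow> a + b \<in> C"
    and uminus_in: "a \<in> C \<Longrightarrow> - a \<in> C"
    and mult_in: "a \<in> C \<Longrightarrow> b \<in> C \<Longrightarrow> a * b \<in> C"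
    and zero_J [simp]: "0 \<in> J"
    and add_J: "s \<in> J \<Longrightarrow> t \<in> J \<Longrightarrow> s + t \<in> J"
    and mult_J: "c \<in> C \<Longrightarrow> t \<in> J \<Longrightarrow> c * t \<in> J"
begin

lemma zero_in [simp]: "0 \<in> C"
  using add_in[OF one_in uminus_in[OF one_in]] by simp

lemma uminus_J: "t \<in> J \<Longrightarrow> - t \<in> J"
  using mult_J[OF uminus_in[OF one_in], of t] by simp

lemma sum_J: "(\<And>i. i \<in> I \<Longrightarrow> f i \<in> J) \<Longrightarrow> sum f I \<in> J"
  by (induction I rule: infinite_finite_induct) (auto intro: add_J)

lemma span_mod_cong: "t \<in> span_mod C J G \<Longrightarrow> s - t \<in> J \<Longrightarrow> s \<in> span_mod C J G"
  unfolding span_mod_def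
proof clarify
  fix d assume "\<forall>g\<in>G. d g \<in> C" "t - (\<Sum>g\<in>G. d g * g) \<in> J" "s - t \<in> J"
  then show "\<exists>d. (\<forall>g\<in>G. d g \<in> C) \<and> s - (\<Sum>g\<in>G. d g * g) \<in> J"
    using add_J[of "s - t" "t - (\<Sum>g\<in>G. d g * g)"] by (intro exI[of _ d]) simp
qed

lemma span_mod_add: "s \<in> span_mod C J G \<Longrightarrow> t \<in> span_mod C J G \<Longrightarrow> s + t \<in> span_mod C J G"
  unfolding span_mod_def
proof clarify
  fix d e assume "\<forall>g\<in>G. d g \<in> C" "s - (\<Sum>g\<in>G. d g * g) \<in> J"
    "\<forall>g\<in>G. e g \<in> C" "t - (\<Sum>g\<in>G. e g * g) \<in> J"
  then show "\<exists>d. (\<forall>g\<in>G. d g \<in> C) \<and> s + t - (\<Sum>g\<in>G. d g * g) \<in> J"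
    using add_J[of "s - (\<Sum>g\<in>G. d g * g)" "t - (\<Sum>g\<in>G. e g * g)"]
    by (intro exI[of _ "\<lambda>g. d g + e g"])
      (auto simp: add_in distrib_right sum.distrib algebra_simps)
qed

lemma span_mod_mult: "c \<in> C \<Longrightarrow> t \<in> span_mod C J G \<Longrightarrow> c * t \<in> span_mod C J G"
  unfolding span_mod_def
proof clarify
  fix d assume "c \<in> C" "\<forall>g\<in>G. d g \<in> C" "t - (\<Sum>g\<in>G. d g * g) \<in> J"
  then show "\<exists>d. (\<forall>g\<in>G. d g \<in> C) \<and> c * t - (\<Sum>g\<in>G. d g * g) \<in> J"
    using mult_J[of c "t - (\<Sum>g\<in>G. d g * g)"]
    by (intro exI[of _ "\<lambda>g. c * d g"])
      (auto simp: mult_in right_diff_distrib sum_distrib_left mult.assoc)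
qed

lemma span_mod_J: "t \<in> J \<Longrightarrow> t \<in> span_mod C J G"
  unfolding span_mod_def by (auto intro!: exI[of _ "\<lambda>_. 0"])

lemma span_mod_sum: "(\<And>i. i \<in> I \<Longrightarrow> f i \<in> span_mod C J G) \<Longrightarrow> sum f I \<in> span_mod C J G"
  by (induction I rule: infinite_finite_induct) (auto intro: span_mod_add span_mod_J)

lemma span_mod_base: "finite G \<Longrightarrow> g \<in> G \<Longrightarrow> g \<in> span_mod C J G"
  unfolding span_mod_def
  by (auto intro!: exI[of _ "\<lambda>i. if i = g then 1 else 0"] simp: if_distrib[of "\<lambda>x. x * _"] cong: if_cong)

lemma span_mod_insert:
  assumes "t \<in> span_mod C J (insert n F)" "finite F" "n \<notin> F"
  obtains c where "c \<in> C" "t - c * n \<in> span_mod C J F"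
proof -
  from assms obtain d where "\<forall>g\<in>insert n F. d g \<in> C" "t - (\<Sum>g\<in>insert n F. d g * g) \<in> J"
    unfolding span_mod_def by blast
  with assms have "d n \<in> C" "t - d n * n \<in> span_mod C J F"
    unfolding span_mod_def by (auto simp: algebra_simps)
  then show ?thesis by (rule that)
qed

lemma mult_span_mod_J:
  assumes "t \<in> span_mod C J G" "s \<in> C" "\<And>g. g \<in> G \<Longrightarrow> s * g \<in> J"
  shows "s * t \<in> J"
proof -
  from assms obtain d where d: "\<forall>g\<in>G. d g \<in> C" "t - (\<Sum>g\<in>G. d g * g) \<in> J"
    unfolding span_mod_def by blast
  have "s * (\<Sum>g\<in>G. d g * g) = (\<Sum>g\<in>G. d g * (s * g))"
    by (simp add: sum_distrib_left algebra_simps)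
  also have "\<dots> \<in> J" using d assms by (intro sum_J) (auto intro: mult_J)
  finally have "s * (t - (\<Sum>g\<in>G. d g * g)) + s * (\<Sum>g\<in>G. d g * g) \<in> J"
    using assms d by (auto intro!: add_J intro: mult_J)
  then show ?thesis by (simp add: algebra_simps)
qed

text \<open>The multiplicative set \<open>S\<close> plays the role of \<open>1 + c C\<close>; it lets the generators be eliminated one at a time
  without determinants. For \<open>algebraic_mod_J\<close> it is the set of polynomials coprime to the one dividing.\<close>

lemma nakayama:
  assumes "finite G" "S \<subseteq> C" "1 \<in> S" "\<And>s t. s \<in> S \<Longrightarrow> t \<in> S \<Longrightarrow> s * t \<in> S" "c \<in> C"
    and S_add: "\<And>s d. s \<in> S \<Longrightarrow> d \<in> C \<Longrightarrow> s + c * d \<in> S"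
    and "\<And>g. g \<in> G \<Longrightarrow> \<exists>s\<in>S. \<exists>w\<in>span_mod C J G. s * g - c * w \<in> J"
  shows "\<exists>s\<in>S. \<forall>g\<in>G. s * g \<in> J"
  using assms(1,7)
proof (induction G rule: finite_induct)
  case empty
  then show ?case using assms by auto
next
  case (insert n F)
  from insert.prems[of n] obtain sn wn where n: "sn \<in> S" "wn \<in> span_mod C J (insert n F)" "sn * n - c * wn \<in> J"
    by auto
  obtain b where b: "b \<in> C" "wn - b * n \<in> span_mod C J F"
    using span_mod_insert[OF n(2) insert.hyps] by blast
  \<comment> \<open>Solving the relation of \<open>n\<close> for \<open>n\<close> moves the term
    \<open>c * b * n\<close> to the left; \<open>s'\<close> is the resulting coefficient, and
    \<open>S_add\<close> keeps it in \<open>S\<close>.\<close>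
  define s' where "s' = sn + c * (- b)"
  define w0 where "w0 = wn - b * n"
  have s': "s' \<in> S" unfolding s'_def by (intro S_add n uminus_in b)
  have "s' * n - c * w0 = sn * n - c * wn" by (simp add: s'_def w0_def algebra_simps)
  with n have s'n: "s' * n - c * w0 \<in> J" by simp
  have "\<exists>s\<in>S. \<exists>w\<in>span_mod C J F. s * i - c * w \<in> J" if i: "i \<in> F" for i
  proof -
    from insert.prems[of i] i obtain si wi where
      si: "si \<in> S" "wi \<in> span_mod C J (insert n F)" "si * i - c * wi \<in> J"
      by auto
    obtain bi where bi: "bi \<in> C" "wi - bi * n \<in> span_mod C J F"
      using span_mod_insert[OF si(2) insert.hyps] by blast
    \<comment> \<open>The relation of \<open>i\<close> is multiplied by \<open>s'\<close>, so that
      \<open>s' * n\<close> can be replaced by \<open>c * w0\<close>; \<open>?w\<close> is the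
      cofactor of \<open>c\<close> and no longer involves \<open>n\<close>.\<close>
    let ?w = "s' * (wi - bi * n) + (bi * c) * w0"
    have "s' * (si * i - c * wi) + (c * bi) * (s' * n - c * w0) \<in> J"
      using s' \<open>S \<subseteq> C\<close> \<open>c \<in> C\<close> bi si s'n by (intro add_J mult_J mult_in) auto
    also have "s' * (si * i - c * wi) + (c * bi) * (s' * n - c * w0) = (s' * si) * i - c * ?w"
      by (simp add: algebra_simps)
    finally have "(s' * si) * i - c * ?w \<in> J" .
    moreover have "?w \<in> span_mod C J F"
      using s' \<open>S \<subseteq> C\<close> \<open>c \<in> C\<close> bi b by (intro span_mod_add span_mod_mult mult_in) (auto simp: w0_def)
    ultimately show ?thesis using assms(4)[OF s' si(1)] by blast
  qed
  from insert.IH[OF this] obtain s where s: "s \<in> S" "\<forall>g\<in>F. s * g \<in> J" by blast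
  \<comment> \<open>\<open>s\<close> sends \<open>F\<close>, hence also \<open>w0\<close>, into
    \<open>J\<close>, so multiplying the relation of \<open>n\<close> by \<open>s\<close> removes
    its right-hand side.\<close>
  have "s * w0 \<in> J"
    using s \<open>S \<subseteq> C\<close> b by (intro mult_span_mod_J[of w0 F]) (auto simp: w0_def)
  then have "s * (s' * n - c * w0) + c * (s * w0) \<in> J"
    using s \<open>S \<subseteq> C\<close> \<open>c \<in> C\<close> s'n by (auto intro!: add_J intro: mult_J)
  then have "s * s' * n \<in> J" by (simp add: algebra_simps)
  moreover have "s * s' * g \<in> J" if "g \<in> F" for g
    using mult_J[of s' "s * g"] s that s' \<open>S \<subseteq> C\<close> by (auto simp: algebra_simps)
  ultimately show ?case using assms(4)[OF s(1) s'] by blast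
qed

end

section \<open>Evaluation of polynomials and the argument of Zariski's lemma\<close>

definition ev :: "('c::comm_ring_1 \<Rightarrow> 'a::comm_ring_1) \<Rightarrow> 'a \<Rightarrow> 'c poly \<Rightarrow> 'a"
  where "ev \<kappa> a f = poly (map_poly \<kappa> f) a"

context comm_ring_hom
begin

lemma ev_pCons: "ev hom a (pCons c f) = hom c + a * ev hom a f"
  by (cases "f = 0 \<and> c = 0") (auto simp: ev_def map_poly_pCons)

lemma ev_0: "ev hom a 0 = 0"
  by (simp add: ev_def)

lemma ev_add: "ev hom a (f + g) = ev hom a f + ev hom a g"
proof -
  have "map_poly hom (f + g) = map_poly hom f + map_poly hom g"
    by (rule poly_eqI) (simp add: coeff_map_poly hom_add)
  then show ?thesis by (simp add: ev_def)
qed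

lemma ev_smult: "ev hom a (Polynomial.smult c f) = hom c * ev hom a f"
  by (induction f) (auto simp: ev_pCons ev_0 hom_mult algebra_simps)

lemma ev_mult: "ev hom a (f * g) = ev hom a f * ev hom a g"
  by (induction f) (auto simp: ev_pCons ev_0 ev_add ev_smult algebra_simps)

lemma ev_altdef:
  assumes "Polynomial.degree f \<le> n"
  shows "ev hom a f = (\<Sum>i\<le>n. hom (Polynomial.coeff f i) * a ^ i)"
proof -
  have "Polynomial.degree (map_poly hom f) \<le> n"
    using assms by (intro degree_le) (simp add: coeff_map_poly coeff_eq_0)
  then have "ev hom a f = (\<Sum>i\<le>n. Polynomial.coeff (map_poly hom f) i * a ^ i)"
    unfolding ev_def poly_altdef by (intro sum.mono_neutral_left) (auto simp: coeff_eq_0)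
  then show ?thesis by (simp add: coeff_map_poly)
qed

text \<open>Allows \<open>ev\<close> to be iterated: the range of \<open>ev (ev hom a) b\<close> is
  the subalgebra generated by \<open>a\<close> and \<open>b\<close>.\<close>

lemma comm_ring_hom_ev: "comm_ring_hom (ev hom a)"
  by standard (simp_all add: ev_0 ev_add ev_mult ev_pCons one_pCons)

end

text \<open>\<open>annihilate\<close> and \<open>divisible\<close> are the form in which Schur's
  lemma enters: an element of \<open>C\<close> acts on the quotient by \<open>J\<close> as zero or
  surjectively.\<close>

locale simple_fg = comm_ring_hom \<kappa> + subring_submodule C J
  for \<kappa> :: "'k::field \<Rightarrow> 'a::comm_ring_1" and C J +
  fixes G :: "'a set"
  assumes finite_G: "finite G" and one_G: "1 \<in> G"
    and span_G: "t \<in> span_mod C J G"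
    and one_notin_J: "1 \<notin> J"
    and annihilate: "c \<in> C \<Longrightarrow> c \<in> J \<Longrightarrow> c * t \<in> J"
    and divisible: "c \<in> C \<Longrightarrow> c \<notin> J \<Longrightarrow> \<exists>t. w - c * t \<in> J"
begin

text \<open>By \<open>divisible\<close> the quotient equals \<open>c\<close> times itself, so
  Nakayama's lemma with \<open>S = 1 + c C\<close> gives an element of \<open>S\<close> sending all
  generators into \<open>J\<close>. One generator is 1, so the element itself lies in
  \<open>J\<close>.\<close>

lemma inverse_mod_J:
  assumes "c \<in> C" "c \<notin> J"
  obtains g where "g \<in> C" "1 + c * g \<in> J"
proof -
  define S where "S = {1 + c * d | d. d \<in> C}"
  have "\<exists>s\<in>S. \<forall>g\<in>G. s * g \<in> J"
  proof (rule nakayama[OF finite_G _ _ _ \<open>c \<in> C\<close>])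
    show "S \<subseteq> C" using assms by (auto simp: S_def intro!: add_in mult_in)
    show one: "1 \<in> S" by (auto simp: S_def intro!: exI[of _ 0])
    show "s * t \<in> S" if st: "s \<in> S" "t \<in> S" for s t
    proof -
      from st obtain d e where "d \<in> C" "e \<in> C" "s = 1 + c * d" "t = 1 + c * e"
        by (auto simp: S_def)
      then show ?thesis unfolding S_def using assms
        by (auto simp: algebra_simps intro!: exI[of _ "d + e + c * d * e"] add_in mult_in)
    qed
    show "s + c * d \<in> S" if sd: "s \<in> S" "d \<in> C" for s d
    proof -
      from sd obtain e where "e \<in> C" "s = 1 + c * e" by (auto simp: S_def)
      then show ?thesis unfolding S_def using sd
        by (auto simp: algebra_simps intro!: exI[of _ "e + d"] add_in)
    qed
    show "\<exists>s\<in>S. \<exists>w\<in>span_mod C J G. s * g - c * w \<in> J" for g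
      using divisible[OF assms, of g] one span_G by (metis mult_1)
  qed
  then obtain s where "s \<in> S" "s * 1 \<in> J" using one_G by blast
  then show ?thesis using that by (auto simp: S_def)
qed

text \<open>If \<open>a\<close> were transcendental modulo \<open>J\<close>, then \<open>b\<close> would satisfy an equation over \<open>F[a]\<close> with some leading
  coefficient \<open>c\<close>, so the quotient would be finitely generated over \<open>F[a]\<close> after inverting \<open>c\<close>. Dividing
  by \<open>1 + a c\<close>, which is coprime to \<open>c\<close>, is then impossible by Nakayama's lemma.\<close>

lemma algebraic_mod_J:
  assumes C: "C = range (ev (ev \<kappa> a) b)"
  obtains f where "f \<noteq> 0" "ev \<kappa> a f \<in> J"
proof (rule ccontr)
  interpret a: comm_ring_hom "ev \<kappa> a" by (rule comm_ring_hom_ev)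
  interpret ab: comm_ring_hom "ev (ev \<kappa> a) b" by (rule a.comm_ring_hom_ev)
  assume "\<not> thesis"
  with that have transc: "f = 0" if "ev \<kappa> a f \<in> J" for f using that by blast
  have evC: "ev (ev \<kappa> a) b q \<in> C" for q using C by blast
  have ev_const: "ev (ev \<kappa> a) b [:s:] = ev \<kappa> a s" for s
    by (simp add: a.ev_pCons a.ev_0)
  have evaC: "ev \<kappa> a s \<in> C" for s using evC[of "[:s:]"] by (simp add: ev_const)
  have ev_b: "ev (ev \<kappa> a) b [:0, 1:] = b" by (simp add: a.ev_pCons a.ev_0)
  have bC: "b \<in> C" using evC[of "[:0,1:]"] by (simp add: ev_b)
  \<comment> \<open>If \<open>b\<close> is not in \<open>J\<close>, its inverse modulo
    \<open>J\<close> is, up to sign, a polynomial in \<open>b\<close> over \<open>F[a]\<close>. The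
    resulting equation has constant coefficient 1, so it is not trivial.\<close>
  obtain q where q: "q \<noteq> 0" "ev (ev \<kappa> a) b q \<in> J"
  proof (cases "b \<in> J")
    case True
    then show ?thesis using that[of "[:0,1:]"] by (simp add: ev_b)
  next
    case False
    then obtain g where "g \<in> C" "1 + b * g \<in> J" using inverse_mod_J bC by blast
    moreover then obtain g' where "g = ev (ev \<kappa> a) b g'" using C by blast
    ultimately show ?thesis using that[of "pCons 1 g'"] by (simp add: a.ev_pCons)
  qed
  define c where "c = lead_coeff q"
  define n where "n = Polynomial.degree q"
  have "c \<noteq> 0" using q by (simp add: c_def)
  define A where "A = range (ev \<kappa> a)"
  interpret A: subring_submodule A J
  proof
    show "1 \<in> A" unfolding A_def using a.hom_one by (metis rangeI)
    show "s + t \<in> A" if "s \<in> A" "t \<in> A" for s t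
      using that unfolding A_def by (auto simp flip: a.hom_add)
    show "- s \<in> A" if "s \<in> A" for s
      using that unfolding A_def by (auto simp flip: a.hom_uminus)
    show "s * t \<in> A" if "s \<in> A" "t \<in> A" for s t
      using that unfolding A_def by (auto simp flip: a.hom_mult)
    show "s * t \<in> J" if "s \<in> A" "t \<in> J" for s t
      using that evaC mult_J unfolding A_def by blast
  qed (auto intro: add_J)
  define W where "W = (\<lambda>(j, g). b ^ j * g) ` ({..n} \<times> G)"
  have finW: "finite W" by (simp add: W_def finite_G)
  have W: "b ^ j * g \<in> W" if "j \<le> n" "g \<in> G" for j g
    using that by (force simp: W_def)
  have reduce: "\<exists>N. ev \<kappa> a (c ^ N) * (d * g) \<in> span_mod A J W" if d: "d \<in> C" and g: "g \<in> G" for d g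
  proof -
    obtain q' where q': "d = ev (ev \<kappa> a) b q'" using d C by blast
    \<comment> \<open>The leading coefficient \<open>c\<close> need not be invertible, so
      pseudo-division takes the place of division, at the price of a power of
      \<open>c\<close>.\<close>
    obtain e r where er: "pseudo_divmod q' q = (e, r)" by force
    define N where "N = Suc (Polynomial.degree q') - Polynomial.degree q"
    from pseudo_divmod[OF q(1) er] have
      eq: "Polynomial.smult (c ^ N) q' = q * e + r" and r: "r = 0 \<or> Polynomial.degree r < Polynomial.degree q"
      by (auto simp: c_def N_def)
    have "ev \<kappa> a (c ^ N) * d = ev (ev \<kappa> a) b q * ev (ev \<kappa> a) b e + ev (ev \<kappa> a) b r"
      unfolding q' by (simp flip: a.ev_smult ab.hom_mult ab.hom_add eq)
    moreover have "ev (ev \<kappa> a) b r * g \<in> span_mod A J W"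
    proof -
      have "Polynomial.degree r \<le> n" using r by (auto simp: n_def)
      then have "ev (ev \<kappa> a) b r = (\<Sum>j\<le>n. ev \<kappa> a (Polynomial.coeff r j) * b ^ j)"
        by (rule a.ev_altdef)
      then have "ev (ev \<kappa> a) b r * g = (\<Sum>j\<le>n. ev \<kappa> a (Polynomial.coeff r j) * (b ^ j * g))"
        by (simp add: sum_distrib_right mult.assoc)
      also have "\<dots> \<in> span_mod A J W"
        by (intro A.span_mod_sum A.span_mod_mult A.span_mod_base finW W g) (auto simp: A_def)
      finally show ?thesis .
    qed
    \<comment> \<open>\<open>annihilate\<close> supplies the absorption that \<open>J\<close>, not
      being an ideal, lacks.\<close>
    moreover have "ev (ev \<kappa> a) b q * (ev (ev \<kappa> a) b e * g) \<in> J"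
      by (intro annihilate evC q)
    moreover have "ev \<kappa> a (c ^ N) * (d * g) - ev (ev \<kappa> a) b r * g = ev (ev \<kappa> a) b q * (ev (ev \<kappa> a) b e * g)"
      using arg_cong[OF calculation(1), of "\<lambda>x. x * g"] by (simp add: distrib_right mult.assoc)
    ultimately have "ev \<kappa> a (c ^ N) * (d * g) \<in> span_mod A J W"
      using A.span_mod_cong by metis
    then show ?thesis ..
  qed
  have reduce': "\<exists>N. ev \<kappa> a (c ^ N) * t \<in> span_mod A J W" for t
  proof -
    obtain d where d: "\<forall>g\<in>G. d g \<in> C" "t - (\<Sum>g\<in>G. d g * g) \<in> J"
      using span_G[of t] unfolding span_mod_def by blast
    have "\<forall>g\<in>G. \<exists>N. ev \<kappa> a (c ^ N) * (d g * g) \<in> span_mod A J W"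
      using reduce d by simp
    then obtain N where N: "\<forall>g\<in>G. ev \<kappa> a (c ^ N g) * (d g * g) \<in> span_mod A J W"
      unfolding bchoice_iff by (elim exE)
    \<comment> \<open>One exponent for all generators: the sum bounds every
      \<open>N g\<close>.\<close>
    define m where "m = sum N G"
    have "ev \<kappa> a (c ^ m) * (d g * g) \<in> span_mod A J W" if "g \<in> G" for g
    proof -
      have "m = (m - N g) + N g" using member_le_sum[of g G N] that finite_G by (simp add: m_def)
      then have "ev \<kappa> a (c ^ m) = ev \<kappa> a (c ^ (m - N g)) * ev \<kappa> a (c ^ N g)"
        by (metis a.hom_mult power_add)
      then show ?thesis
        using A.span_mod_mult[OF _ N[rule_format, OF that], of "ev \<kappa> a (c ^ (m - N g))"] by (simp add: A_def mult.assoc)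
    qed
    then have "(\<Sum>g\<in>G. ev \<kappa> a (c ^ m) * (d g * g)) \<in> span_mod A J W" by (rule A.span_mod_sum)
    moreover have "ev \<kappa> a (c ^ m) * (t - (\<Sum>g\<in>G. d g * g)) \<in> J"
      using d evaC mult_J by blast
    ultimately have "ev \<kappa> a (c ^ m) * t \<in> span_mod A J W"
      by (elim A.span_mod_cong) (simp add: sum_distrib_left right_diff_distrib)
    then show ?thesis ..
  qed
  \<comment> \<open>The factor \<open>[:0, 1:]\<close> makes \<open>f\<close> nonconstant even if
    \<open>c\<close> is a constant.\<close>
  define f where "f = 1 + [:0, 1:] * c"
  have deg: "Polynomial.degree f = Suc (Polynomial.degree c)"
    using \<open>c \<noteq> 0\<close> unfolding f_def by (subst degree_add_eq_right) (auto simp: degree_pCons_eq)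
  \<comment> \<open>The polynomials that are units modulo \<open>f\<close>. The powers of
    \<open>c\<close> are among them, so the denominators of \<open>reduce'\<close> are allowed as
    multipliers in \<open>nakayama\<close>.\<close>
  define B where "B = {s. \<exists>v w. v * s + w * f = 1}"
  have B_mult: "s * t \<in> B" if "s \<in> B" "t \<in> B" for s t
  proof -
    from that obtain v w v' w' where vw: "v * s + w * f = 1" "v' * t + w' * f = 1"
      by (auto simp: B_def)
    have "(v * v') * (s * t) + (v * s * w' + w * (v' * t + w' * f)) * f = (v * s + w * f) * (v' * t + w' * f)"
      by (simp add: algebra_simps)
    then show ?thesis unfolding B_def vw by auto
  qed
  have "1 * 1 + 0 * f = 1" by simp
  then have B_1: "1 \<in> B" unfolding B_def by blast
  have "(- [:0, 1:]) * c + 1 * f = 1" by (simp add: f_def)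
  then have "c \<in> B" unfolding B_def by blast
  then have B_power: "c ^ N \<in> B" for N
    by (induction N) (auto intro: B_mult B_1)
  have "f \<noteq> 0" using deg by auto
  then have "ev \<kappa> a f \<notin> J" using transc by blast
  define S where "S = ev \<kappa> a ` B"
  have "\<exists>s\<in>S. \<forall>g\<in>W. s * g \<in> J"
  proof (rule A.nakayama[OF finW, where c = "ev \<kappa> a f"])
    show "S \<subseteq> A" by (auto simp: S_def A_def)
    show "1 \<in> S" unfolding S_def using B_1 a.hom_one by (metis image_eqI)
    show "s * t \<in> S" if "s \<in> S" "t \<in> S" for s t
      using that unfolding S_def by (auto simp flip: a.hom_mult intro: B_mult)
    show "ev \<kappa> a f \<in> A" by (simp add: A_def)
    show "s + ev \<kappa> a f * d \<in> S" if sd: "s \<in> S" "d \<in> A" for s d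
    proof -
      from sd obtain s' d' where "s = ev \<kappa> a s'" "d = ev \<kappa> a d'" "s' \<in> B"
        by (auto simp: S_def A_def)
      moreover have "s' + f * d' \<in> B"
      proof -
        from \<open>s' \<in> B\<close> obtain v w where "v * s' + w * f = 1" by (auto simp: B_def)
        then have "v * (s' + f * d') + (w - v * d') * f = 1" by (simp add: algebra_simps)
        then show ?thesis unfolding B_def by blast
      qed
      ultimately show ?thesis unfolding S_def by (auto simp flip: a.hom_mult a.hom_add)
    qed
    show "\<exists>s\<in>S. \<exists>w\<in>span_mod A J W. s * g - ev \<kappa> a f * w \<in> J" for g
    proof -
      obtain t where t: "g - ev \<kappa> a f * t \<in> J"
        using divisible[OF evaC \<open>ev \<kappa> a f \<notin> J\<close>] by blast
      \<comment> \<open>The quotient \<open>t\<close> reaches the span only after its denominators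
        are cleared.\<close>
      obtain N where N: "ev \<kappa> a (c ^ N) * t \<in> span_mod A J W" using reduce' by blast
      have "ev \<kappa> a (c ^ N) * (g - ev \<kappa> a f * t) \<in> J" by (intro mult_J evaC t)
      then have "ev \<kappa> a (c ^ N) * g - ev \<kappa> a f * (ev \<kappa> a (c ^ N) * t) \<in> J"
        by (simp add: algebra_simps)
      moreover have "ev \<kappa> a (c ^ N) \<in> S" unfolding S_def using B_power by auto
      ultimately show ?thesis using N by blast
    qed
  qed
  then obtain s where s: "s \<in> B" "\<forall>g\<in>W. ev \<kappa> a s * g \<in> J" by (auto simp: S_def)
  have "1 \<in> W" using W[of 0 1] one_G by simp
  with s have "ev \<kappa> a s \<in> J" by force
  \<comment> \<open>Now 0 is a unit modulo \<open>f\<close>, so \<open>f\<close> itself is a unit,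
    against its positive degree.\<close>
  then have "s = 0" by (rule transc)
  with s obtain w where "w * f = 1" by (auto simp: B_def)
  then have "is_unit f" by (metis dvd_triv_right)
  with deg \<open>f \<noteq> 0\<close> show False by (simp add: is_unit_iff_degree)
qed

end

text \<open>Used in both orders, this makes the generated subalgebra symmetric in \<open>a\<close>
  and \<open>b\<close>, so that \<open>algebraic_mod_J\<close> applies to either of them.\<close>

lemma (in comm_ring_hom) range_ev_ev_subset:
  "range (ev (ev hom a) b) \<subseteq> range (ev (ev hom b) a)"
proof -
  interpret a: comm_ring_hom "ev hom a" by (rule comm_ring_hom_ev)
  interpret b: comm_ring_hom "ev hom b" by (rule comm_ring_hom_ev)
  interpret ba: comm_ring_hom "ev (ev hom b) a" by (rule b.comm_ring_hom_ev)
  let ?R = "range (ev (ev hom b) a)"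
  have add: "s + t \<in> ?R" if "s \<in> ?R" "t \<in> ?R" for s t
    using that by (auto simp flip: ba.hom_add)
  have mult: "s * t \<in> ?R" if "s \<in> ?R" "t \<in> ?R" for s t
    using that by (auto simp flip: ba.hom_mult)
  have const: "hom c \<in> ?R" for c
    by (rule range_eqI[of _ _ "[:[:c:]:]"]) (simp add: ev_pCons ev_0 b.ev_pCons b.ev_0)
  have a: "a \<in> ?R"
    by (rule range_eqI[of _ _ "[:0, 1:]"]) (simp add: b.ev_pCons b.ev_0)
  have b: "b \<in> ?R"
    by (rule range_eqI[of _ _ "[:[:0, 1:]:]"]) (simp add: ev_pCons ev_0 b.ev_pCons b.ev_0)
  have zero: "0 \<in> ?R" using const[of 0] by simp
  have ev_a: "ev hom a s \<in> ?R" for s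
    by (induction s) (auto simp only: ev_0 ev_pCons intro: zero add mult const a)
  have "ev (ev hom a) b q \<in> ?R" for q
  proof (induction q)
    case (pCons c q)
    show ?case unfolding a.ev_pCons by (intro add mult ev_a b pCons.IH)
  qed (simp only: a.ev_0 zero)
  then show ?thesis by blast
qed

text \<open>Both \<open>a\<close> and \<open>b\<close> satisfy an equation modulo \<open>J\<close>;
  taking remainders bounds their exponents, and finitely many monomials times \<open>G\<close>
  suffice.\<close>

lemma (in simple_fg) finite_dim_mod_J:
  assumes C: "C = range (ev (ev \<kappa> a) b)"
  obtains W where "finite W" "\<And>t. t \<in> span_mod (range \<kappa>) J W"
proof -
  interpret a: comm_ring_hom "ev \<kappa> a" by (rule comm_ring_hom_ev)
  interpret b: comm_ring_hom "ev \<kappa> b" by (rule comm_ring_hom_ev)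
  have C': "C = range (ev (ev \<kappa> b) a)"
    unfolding C by (intro subset_antisym range_ev_ev_subset)
  have evaC: "ev \<kappa> a s \<in> C" for s
    unfolding C by (rule range_eqI[of _ _ "[:s:]"]) (simp add: a.ev_pCons a.ev_0)
  have evbC: "ev \<kappa> b s \<in> C" for s
    unfolding C' by (rule range_eqI[of _ _ "[:s:]"]) (simp add: b.ev_pCons b.ev_0)
  obtain f where f: "f \<noteq> 0" "ev \<kappa> a f \<in> J" using algebraic_mod_J[OF C] .
  obtain f' where f': "f' \<noteq> 0" "ev \<kappa> b f' \<in> J" using algebraic_mod_J[OF C'] .
  define K where "K = range \<kappa>"
  have K: "\<kappa> c \<in> K" for c by (simp add: K_def)
  have "\<kappa> c \<in> C" for c using evaC[of "[:c:]"] by (simp add: ev_pCons ev_0)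
  then have "K \<subseteq> C" by (auto simp: K_def)
  interpret K: subring_submodule K J
  proof
    show "1 \<in> K" using K[of 1] by simp
    show "s + t \<in> K" if "s \<in> K" "t \<in> K" for s t
      using that unfolding K_def by (auto simp flip: hom_add)
    show "- s \<in> K" if "s \<in> K" for s
      using that unfolding K_def by (auto simp flip: hom_uminus)
    show "s * t \<in> K" if "s \<in> K" "t \<in> K" for s t
      using that unfolding K_def by (auto simp flip: hom_mult)
    show "s * t \<in> J" if "s \<in> K" "t \<in> J" for s t
      using that \<open>K \<subseteq> C\<close> mult_J by blast
  qed (auto intro: add_J)
  define m where "m = Polynomial.degree f"
  define n where "n = Polynomial.degree f'"
  define W where "W = (\<lambda>(i, j, g). a ^ i * (b ^ j * g)) ` ({..m} \<times> {..n} \<times> G)"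
  have finW: "finite W" by (simp add: W_def finite_G)
  have W: "a ^ i * (b ^ j * g) \<in> W" if "i \<le> m" "j \<le> n" "g \<in> G" for i j g
    using that by (force simp: W_def)
  have base: "ev \<kappa> a s * (ev \<kappa> b s' * g) \<in> span_mod K J W" if g: "g \<in> G" for s s' g
  proof -
    define r where "r = s mod f"
    define r' where "r' = s' mod f'"
    have deg: "Polynomial.degree r \<le> m" "Polynomial.degree r' \<le> n"
      using degree_mod_less'[OF f(1), of s] degree_mod_less'[OF f'(1), of s']
      by (cases "r = 0"; cases "r' = 0"; force simp: m_def n_def r_def r'_def)+
    have s: "ev \<kappa> a s = ev \<kappa> a f * ev \<kappa> a (s div f) + ev \<kappa> a r"
      by (simp add: r_def flip: a.hom_mult a.hom_add)
    have s': "ev \<kappa> b s' = ev \<kappa> b f' * ev \<kappa> b (s' div f') + ev \<kappa> b r'"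
      by (simp add: r'_def flip: b.hom_mult b.hom_add)
    \<comment> \<open>Reducing both factors changes the product by multiples of
      \<open>ev \<kappa> a f\<close> and \<open>ev \<kappa> b f'\<close> only.\<close>
    have "ev \<kappa> a s * (ev \<kappa> b s' * g) - ev \<kappa> a r * (ev \<kappa> b r' * g)
      = ev \<kappa> a f * (ev \<kappa> a (s div f) * (ev \<kappa> b s' * g)) + ev \<kappa> b f' * (ev \<kappa> b (s' div f') * ev \<kappa> a r * g)"
      unfolding s s' by (simp add: algebra_simps)
    also have "\<dots> \<in> J" by (intro add_J annihilate evaC evbC f f')
    finally have J: "ev \<kappa> a s * (ev \<kappa> b s' * g) - ev \<kappa> a r * (ev \<kappa> b r' * g) \<in> J" .
    have "ev \<kappa> a r * (ev \<kappa> b r' * g) =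
        (\<Sum>i\<le>m. \<Sum>j\<le>n. \<kappa> (Polynomial.coeff r i) * (\<kappa> (Polynomial.coeff r' j) * (a ^ i * (b ^ j * g))))"
      unfolding ev_altdef[OF deg(1)] ev_altdef[OF deg(2)]
      by (subst sum.swap) (simp add: sum_distrib_left sum_distrib_right algebra_simps)
    also have "\<dots> \<in> span_mod K J W"
      by (intro K.span_mod_sum K.span_mod_mult K.span_mod_base K W finW g) auto
    finally show ?thesis using J by (rule K.span_mod_cong)
  qed
  have "t \<in> span_mod K J W" for t
  proof -
    obtain d where d: "\<forall>g\<in>G. d g \<in> C" "t - (\<Sum>g\<in>G. d g * g) \<in> J"
      using span_G[of t] unfolding span_mod_def by blast
    have "d g * g \<in> span_mod K J W" if g: "g \<in> G" for g
    proof -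
      obtain q where q: "d g = ev (ev \<kappa> a) b q" using d g C by blast
      \<comment> \<open>The power of \<open>b\<close> is written as an evaluation so that
        \<open>base\<close> can reduce its exponent too.\<close>
      have "ev \<kappa> b (Polynomial.monom 1 j) = b ^ j" for j
        by (induction j) (simp_all add: ev_pCons ev_0 one_pCons Polynomial.monom_0 Polynomial.monom_Suc)
      then have "d g * g = (\<Sum>j\<le>Polynomial.degree q. ev \<kappa> a (Polynomial.coeff q j) * (ev \<kappa> b (Polynomial.monom 1 j) * g))"
        unfolding q by (simp add: a.ev_altdef[OF order.refl] sum_distrib_right mult.assoc)
      also have "\<dots> \<in> span_mod K J W" by (intro K.span_mod_sum base g)
      finally show ?thesis .
    qed
    then have "(\<Sum>g\<in>G. d g * g) \<in> span_mod K J W" by (rule K.span_mod_sum)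
    then show ?thesis using d by (blast intro: K.span_mod_cong)
  qed
  then show ?thesis using that finW unfolding K_def by blast
qed

section \<open>Derivations in characteristic p\<close>

text \<open>A common form of the Leibniz rule and of the expansion of a sum of commuting operators:
  \<open>F i j\<close> is \<open>delta^i f * delta^j g\<close> in \<open>delta_pow_mult\<close> and
  \<open>y^j * delta_y^i t\<close> in \<open>z_mult\<close>.\<close>

lemma iterate_pascal:
  fixes F :: "nat \<Rightarrow> nat \<Rightarrow> 'a::ring_1"
  assumes D_add: "\<And>s t. D (s + t) = D s + D t"
    and D_F: "\<And>i j. D (F i j) = F (Suc i) j + F i (Suc j)"
  shows "(D ^^ n) (F i j) = (\<Sum>k\<le>n. of_nat (n choose k) * F (i + k) (j + (n - k)))"
proof (induction n arbitrary: i j)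
  case (Suc n)
  have D_n_add: "(D ^^ n) (s + t) = (D ^^ n) s + (D ^^ n) t" for s t
    by (induction n) (simp_all add: D_add)
  have "(D ^^ Suc n) (F i j) = (D ^^ n) (F (Suc i) j) + (D ^^ n) (F i (Suc j))"
    by (simp add: funpow_Suc_right D_F D_n_add del: funpow.simps)
  also have "(D ^^ n) (F (Suc i) j) = (\<Sum>k\<le>n. of_nat (n choose k) * F (i + Suc k) (j + (n - k)))"
    by (simp add: Suc.IH)
  also have "(D ^^ n) (F i (Suc j)) = (\<Sum>k\<le>Suc n. of_nat (n choose k) * F (i + k) (j + (Suc n - k)))"
    by (simp add: Suc.IH Suc_diff_le binomial_eq_0)
  also have "\<dots> = F i (j + Suc n) + (\<Sum>k\<le>n. of_nat (n choose Suc k) * F (i + Suc k) (j + (n - k)))"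
    by (subst sum.atMost_Suc_shift) simp
  finally show ?case
    by (subst sum.atMost_Suc_shift) (simp add: sum.distrib distrib_right algebra_simps)
qed simp

text \<open>The prime \<open>p\<close> divides the inner binomial coefficients, so only the outer
  two terms survive.\<close>

lemma iterate_CHAR:
  fixes F :: "nat \<Rightarrow> nat \<Rightarrow> 'a::idom"
  assumes "\<And>s t. D (s + t) = D s + D t"
    and "\<And>i j. D (F i j) = F (Suc i) j + F i (Suc j)"
    and "CHAR('a) = p" "p > 0"
  shows "(D ^^ p) (F i j) = F (i + p) j + F i (j + p)"
proof -
  have "prime p" using prime_CHAR_semidom[where 'a = 'a] assms by simp
  have "(of_nat (p choose k) :: 'a) = 0" if "0 < k" "k < p" for k
    using dvd_choose_prime[of k p] that \<open>prime p\<close> assms(3) by (auto simp: of_nat_eq_0_iff_char_dvd)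
  then have "(\<Sum>k\<le>p. of_nat (p choose k) * F (i + k) (j + (p - k)))
      = (\<Sum>k\<in>{0, p}. of_nat (p choose k) * F (i + k) (j + (p - k)))"
    by (intro sum.mono_neutral_right) auto
  then show ?thesis
    using \<open>p > 0\<close> by (subst iterate_pascal[of D F, OF assms(1,2)]) (simp_all add: add.commute)
qed

section \<open>The derivation delta, its p-th power, and the elements u and z\<close>

definition delta :: "'k::field poly \<Rightarrow> 'k poly \<Rightarrow> 'k poly"
  where "delta h f = h * pderiv f"

definition delta_y :: "'k::field poly \<Rightarrow> 'k poly poly \<Rightarrow> 'k poly poly"
  where "delta_y h = map_poly (delta h)"

text \<open>Left multiplication by \<open>y\<close> in normally ordered form:
  \<open>y f = f y + delta f\<close>, while the powers of \<open>y\<close> behind \<open>f\<close>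
  stay on the right.\<close>

definition y_op :: "'k::field poly \<Rightarrow> 'k poly poly \<Rightarrow> 'k poly poly"
  where "y_op h t = pCons 0 t + delta_y h t"

lemma delta_0 [simp]: "delta h 0 = 0"
  by (simp add: delta_def)

lemma delta_add: "delta h (f + g) = delta h f + delta h g"
  by (simp add: delta_def pderiv_add algebra_simps)

lemma delta_mult: "delta h (f * g) = delta h f * g + f * delta h g"
  by (simp add: delta_def pderiv_mult algebra_simps)

lemma delta_const [simp]: "delta h [:c:] = 0"
  by (simp add: delta_def)

lemma coeff_delta_y: "Polynomial.coeff (delta_y h t) j = delta h (Polynomial.coeff t j)"
  by (simp add: delta_y_def coeff_map_poly)

lemma delta_y_0 [simp]: "delta_y h 0 = 0"
  by (simp add: delta_y_def)

lemma delta_y_pCons: "delta_y h (pCons f t) = pCons (delta h f) (delta_y h t)"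
  by (rule poly_eqI) (simp add: coeff_delta_y coeff_pCons split: nat.split)

lemma delta_y_add: "delta_y h (s + t) = delta_y h s + delta_y h t"
  by (rule poly_eqI) (simp add: coeff_delta_y delta_add)

lemma delta_y_smult: "delta_y h (Polynomial.smult f t) = Polynomial.smult (delta h f) t + Polynomial.smult f (delta_y h t)"
  by (rule poly_eqI) (simp add: coeff_delta_y delta_mult)

lemma delta_y_mult: "delta_y h (s * t) = delta_y h s * t + s * delta_y h t"
  by (induction s) (simp_all add: delta_y_pCons delta_y_add delta_y_smult algebra_simps)

lemma delta_y_monom: "delta_y h (Polynomial.monom f n) = Polynomial.monom (delta h f) n"
  by (rule poly_eqI) (simp add: coeff_delta_y)

lemma y_op_add: "y_op h (s + t) = y_op h s + y_op h t"
  using add_pCons[of 0 s 0 t] by (simp add: y_op_def delta_y_add algebra_simps del: add_pCons)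

lemma y_op_0 [simp]: "y_op h 0 = 0"
  by (simp add: y_op_def)

lemma y_op_mult: "y_op h (c * t) = c * y_op h t + delta_y h c * t"
  by (simp add: y_op_def delta_y_mult algebra_simps)

lemma y_op_pCons: "y_op h (pCons f t) = pCons (delta h f) (pCons f 0 + y_op h t)"
  by (simp add: y_op_def delta_y_pCons)

text \<open>The polynomial \<open>r\<close> with \<open>\<delta>^p = r \<delta>\<close>: since \<open>\<delta>^p\<close> is a derivation, \<open>r h = \<delta>^p x\<close>.\<close>

definition delta_quot :: "'k::field poly \<Rightarrow> nat \<Rightarrow> 'k poly"
  where "delta_quot h p = pderiv ((delta h ^^ (p - 1)) [:0, 1:])"

locale weyl_char =
  fixes h :: "'k::field poly" and p :: nat
  assumes CHAR: "CHAR('k) = p" and p_pos: "p > 0" and h_nz: "h \<noteq> 0"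
begin

lemma p_gt_1: "p > 1"
  using prime_CHAR_semidom[where 'a = 'k] CHAR p_pos prime_gt_1_nat by simp

lemma delta_pow_mult: "(delta h ^^ p) (f * g) = (delta h ^^ p) f * g + f * (delta h ^^ p) g"
  using iterate_CHAR[of "delta h" "\<lambda>i j. (delta h ^^ i) f * (delta h ^^ j) g" p 0 0]
  by (simp add: delta_add delta_mult CHAR p_pos)

text \<open>Both sides are derivations that vanish on constants and agree at \<open>x\<close>;
  writing \<open>pCons c f\<close> as \<open>c + x f\<close> reduces the claim to these
  cases.\<close>

lemma delta_pow: "(delta h ^^ p) f = delta_quot h p * delta h f"
proof (induction f)
  case 0
  have "(delta h ^^ n) 0 = 0" for n by (induction n) auto
  then show ?case by simp
next
  case (pCons c f)
  have const: "(delta h ^^ p) [:c:] = 0" for c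
  proof -
    have "(delta h ^^ Suc n) [:c:] = 0" for n by (induction n) auto
    from this[of "p - 1"] show ?thesis using p_pos by simp
  qed
  have x: "(delta h ^^ p) [:0, 1:] = delta_quot h p * h"
  proof -
    have "(delta h ^^ Suc (p - 1)) [:0, 1:] = delta_quot h p * h" by (simp add: delta_quot_def delta_def)
    then show ?thesis using p_pos by simp
  qed
  have add: "(delta h ^^ n) (f + g) = (delta h ^^ n) f + (delta h ^^ n) g" for n f g
    by (induction n) (simp_all add: delta_add)
  have eq: "pCons c f = [:c:] + [:0, 1:] * f" by simp
  have "delta h (pCons c f) = h * f + [:0, 1:] * delta h f"
    by (simp add: delta_def pderiv_pCons algebra_simps)
  then show ?case unfolding eq add delta_pow_mult const x pCons.IH
    by (simp add: algebra_simps)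
qed

text \<open>\<open>delta\<close> commutes with its own power. With
  \<open>r = delta_quot h p\<close>, comparing both orders on \<open>x\<close> gives
  \<open>delta (r h) = r * delta h\<close>, hence \<open>delta r * h = 0\<close>, and
  \<open>h\<close> cancels.\<close>

lemma delta_delta_quot: "delta h (delta_quot h p) = 0"
proof -
  have "delta h ((delta h ^^ p) [:0, 1:]) = (delta h ^^ p) (delta h [:0, 1:])"
    by (simp add: funpow_swap1)
  moreover have "delta h [:0, 1:] = h" by (simp add: delta_def pderiv_pCons)
  ultimately have "delta h (delta_quot h p) * h = 0"
    by (simp add: delta_pow delta_mult)
  then show ?thesis using h_nz by simp
qed

definition u :: "'k poly poly" where "u = [:Polynomial.monom 1 p:]"
definition z :: "'k poly poly" where "z = Polynomial.monom 1 p - Polynomial.monom (delta_quot h p) 1"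

lemma delta_y_u: "delta_y h u = 0"
proof -
  have "pderiv (Polynomial.monom 1 p :: 'k poly) = 0"
    using of_nat_CHAR[where 'a = 'k] by (simp add: pderiv_monom CHAR)
  then show ?thesis by (simp add: u_def delta_y_pCons delta_def)
qed

lemma delta_y_z: "delta_y h z = 0"
proof -
  have "delta h 1 = 0" by (simp add: delta_def)
  have "delta_y h (z + Polynomial.monom (delta_quot h p) 1) = 0"
    by (simp add: z_def delta_y_monom \<open>delta h 1 = 0\<close>)
  then show ?thesis by (simp add: delta_y_add delta_y_monom delta_delta_quot)
qed

text \<open>Multiplication by \<open>y\<close> commutes with \<open>delta_y\<close>, so in
  characteristic \<open>p\<close> the power \<open>y_op^p\<close> is \<open>y^p + delta_y^p\<close>.
  Since \<open>delta_y^p = r delta_y\<close> with \<open>r = delta_quot h p\<close>, subtracting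
  \<open>r y_op\<close> cancels the derivation part.\<close>

lemma z_mult: "z * t = (y_op h ^^ p) t - [:delta_quot h p:] * y_op h t"
proof -
  let ?m = "\<lambda>j. Polynomial.monom 1 j :: 'k poly poly"
  have one: "delta h 1 = 0" by (simp add: delta_def)
  have y: "y_op h (?m j * s) = ?m j * delta_y h s + ?m (Suc j) * s" for j s
    by (simp add: y_op_def delta_y_mult delta_y_monom one monom_Suc)
  have "(y_op h ^^ p) (?m 0 * (delta_y h ^^ 0) t) = ?m 0 * (delta_y h ^^ p) t + ?m p * t"
    using iterate_CHAR[of "y_op h" "\<lambda>i j. ?m j * (delta_y h ^^ i) t" p 0 0]
    by (simp add: y_op_add y CHAR p_pos)
  moreover have "Polynomial.coeff ((delta_y h ^^ n) t) j = (delta h ^^ n) (Polynomial.coeff t j)" for n j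
    by (induction n) (simp_all add: coeff_delta_y)
  then have "(delta_y h ^^ p) t = Polynomial.smult (delta_quot h p) (delta_y h t)"
    by (intro poly_eqI) (simp add: delta_pow coeff_delta_y)
  ultimately show ?thesis
    by (simp add: z_def y_op_def left_diff_distrib monom_Suc monom_0 smult_add_right)
qed

end

section \<open>Invariant subspaces and the subring generated by the central elements\<close>

definition invariant :: "'k::field poly \<Rightarrow> 'k poly poly set \<Rightarrow> bool"
  where "invariant h L \<longleftrightarrow> 0 \<in> L \<and> (\<forall>s\<in>L. \<forall>t\<in>L. s + t \<in> L) \<and>
    (\<forall>c. \<forall>t\<in>L. [:[:c:]:] * t \<in> L) \<and> (\<forall>t\<in>L. [:[:0, 1:]:] * t \<in> L) \<and> (\<forall>t\<in>L. y_op h t \<in> L)"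

lemma
  assumes "invariant h L"
  shows invariant_0: "0 \<in> L"
    and invariant_add: "s \<in> L \<Longrightarrow> t \<in> L \<Longrightarrow> s + t \<in> L"
    and invariant_const: "t \<in> L \<Longrightarrow> [:[:c:]:] * t \<in> L"
    and invariant_x: "t \<in> L \<Longrightarrow> [:[:0, 1:]:] * t \<in> L"
    and invariant_y: "t \<in> L \<Longrightarrow> y_op h t \<in> L"
  using assms unfolding invariant_def by blast+

lemma mult_coeff_closed:
  fixes L :: "'k::field poly poly set"
  assumes "0 \<in> L" "\<And>s t. s \<in> L \<Longrightarrow> t \<in> L \<Longrightarrow> s + t \<in> L"
    and const: "\<And>c t. t \<in> L \<Longrightarrow> [:[:c:]:] * t \<in> L" and x: "\<And>t. t \<in> L \<Longrightarrow> [:[:0, 1:]:] * t \<in> L"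
    and "t \<in> L"
  shows "[:f:] * t \<in> L"
proof (induction f)
  case (pCons c f)
  have "[:pCons c f:] * t = [:[:c:]:] * t + [:[:0, 1:]:] * ([:f:] * t)"
    by (simp flip: smult_add_left)
  then show ?case using assms(2)[OF const[OF \<open>t \<in> L\<close>] x[OF pCons.IH]] by metis
qed (use assms in simp)

text \<open>Stated for ordinary multiplication by \<open>y\<close>, not for \<open>y_op\<close>,
  because it is applied to a span over \<open>C\<close>.\<close>

lemma UNIV_if_closed:
  fixes L :: "'k::field poly poly set"
  assumes "0 \<in> L" "\<And>s t. s \<in> L \<Longrightarrow> t \<in> L \<Longrightarrow> s + t \<in> L"
    and "\<And>c t. t \<in> L \<Longrightarrow> [:[:c:]:] * t \<in> L" and "\<And>t. t \<in> L \<Longrightarrow> [:[:0, 1:]:] * t \<in> L"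
    and y: "\<And>t. t \<in> L \<Longrightarrow> [:0, 1:] * t \<in> L" and "1 \<in> L"
  shows "t \<in> L"
proof (induction t)
  case (pCons f t)
  have "pCons f t = [:f:] * 1 + [:0, 1:] * t" by simp
  then show ?case
    using assms(2)[OF mult_coeff_closed[OF assms(1-4) \<open>1 \<in> L\<close>, of f] y[OF pCons.IH]] by metis
qed (rule assms)

context weyl_char
begin

abbreviation cst :: "'k \<Rightarrow> 'k poly poly" where "cst c \<equiv> [:[:c:]:]"

definition C :: "'k poly poly set" where "C = range (ev (ev cst u) z)"

sublocale cst: comm_ring_hom cst
  by standard (simp_all add: pCons_one)

sublocale u: comm_ring_hom "ev cst u" by (rule cst.comm_ring_hom_ev)

sublocale z: comm_ring_hom "ev (ev cst u) z" by (rule u.comm_ring_hom_ev)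

lemma C_add: "s \<in> C \<Longrightarrow> t \<in> C \<Longrightarrow> s + t \<in> C"
  unfolding C_def by (auto simp flip: z.hom_add)

lemma C_mult: "s \<in> C \<Longrightarrow> t \<in> C \<Longrightarrow> s * t \<in> C"
  unfolding C_def by (auto simp flip: z.hom_mult)

lemma C_uminus: "s \<in> C \<Longrightarrow> - s \<in> C"
  unfolding C_def by (auto simp flip: z.hom_uminus)

lemma cst_C: "cst c \<in> C"
  unfolding C_def
  by (rule range_eqI[of _ _ "[:[:c:]:]"]) (simp only: u.ev_pCons u.ev_0 cst.ev_pCons cst.ev_0 mult_zero_right add_0_right)

lemma u_C: "u \<in> C"
  unfolding C_def
  by (rule range_eqI[of _ _ "[:[:0, 1:]:]"])
    (simp only: u.ev_pCons u.ev_0 cst.ev_pCons cst.ev_0, simp)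

lemma z_C: "z \<in> C"
  unfolding C_def
  by (rule range_eqI[of _ _ "[:0, 1:]"]) (simp only: u.ev_pCons u.ev_0 u.hom_zero u.hom_one, simp)

lemma C_induct [consumes 1, case_names cst u z add mult]:
  assumes "c \<in> C" and cst: "\<And>c. P (cst c)" and u: "P u" and z: "P z"
    and add: "\<And>s t. P s \<Longrightarrow> P t \<Longrightarrow> P (s + t)" and mult: "\<And>s t. P s \<Longrightarrow> P t \<Longrightarrow> P (s * t)"
  shows "P c"
proof -
  have zero: "P 0" using cst[of 0] by simp
  have eu: "P (ev cst u s)" for s
  proof (induction s)
    case (pCons c s)
    show ?case unfolding cst.ev_pCons by (intro add mult cst u pCons.IH)
  qed (simp only: cst.ev_0 zero)
  have "P (ev (ev cst u) z q)" for q
  proof (induction q)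
    case (pCons s q)
    show ?case unfolding u.ev_pCons by (intro add mult eu z pCons.IH)
  qed (simp only: u.ev_0 zero)
  then show ?thesis using \<open>c \<in> C\<close> unfolding C_def by blast
qed

lemma delta_y_C: "c \<in> C \<Longrightarrow> delta_y h c = 0"
  by (induction c rule: C_induct) (simp_all add: delta_y_pCons delta_y_u delta_y_z delta_y_add delta_y_mult)

text \<open>\<open>C\<close> consists of constants of \<open>delta_y\<close>. Hence kernels and
  images of multiplications by elements of \<open>C\<close> are invariant, which is what Schur's
  lemma needs.\<close>

lemma y_op_C: "c \<in> C \<Longrightarrow> y_op h (c * t) = c * y_op h t"
  by (simp add: y_op_mult delta_y_C)

text \<open>It suffices to treat the generators of \<open>C\<close>: \<open>u\<close> is a
  polynomial in \<open>x\<close>, and \<open>z_mult\<close> expresses \<open>z\<close> through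
  \<open>y_op\<close>.\<close>

lemma invariant_C:
  assumes L: "invariant h L" and "c \<in> C" "t \<in> L"
  shows "c * t \<in> L"
proof -
  have coeff: "[:f:] * t \<in> L" if "t \<in> L" for f t
    by (rule mult_coeff_closed[OF invariant_0[OF L] invariant_add[OF L] invariant_const[OF L] invariant_x[OF L] that])
  show ?thesis
    using assms(2,3)
  proof (induction c arbitrary: t rule: C_induct)
    case (cst c)
    then show ?case by (rule invariant_const[OF L])
  next
    case u
    then show ?case unfolding u_def by (rule coeff)
  next
    case z
    have "(y_op h ^^ n) t \<in> L" for n using z by (induction n) (auto intro: invariant_y[OF L])
    moreover have "[:- delta_quot h p:] * y_op h t \<in> L"
      using z by (intro coeff invariant_y[OF L])
    ultimately have "(y_op h ^^ p) t + [:- delta_quot h p:] * y_op h t \<in> L" by (intro invariant_add[OF L])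
    then show ?case by (simp add: z_mult)
  next
    case (add s t)
    then show ?case by (auto simp: distrib_right intro: invariant_add[OF L])
  next
    case (mult s t)
    then show ?case by (simp add: mult.assoc)
  qed
qed

definition G :: "'k poly poly set"
  where "G = (\<lambda>(i, j). Polynomial.monom (Polynomial.monom 1 i) j) ` ({..<p} \<times> {..<p})"

lemma subring_submodule_0: "subring_submodule C {0}"
  by standard (auto simp: C_add C_mult C_uminus intro: cst_C[of 1, unfolded pCons_one])

text \<open>With \<open>{0}\<close> for \<open>J\<close>, congruence is equality. The span contains
  1, so stability under scalars, \<open>x\<close> and \<open>y\<close> is enough, and only an
  exponent reaching \<open>p\<close> leads out of \<open>G\<close>.\<close>

lemma span_G_0: "t \<in> span_mod C {0} G"
proof -
  interpret Z: subring_submodule C "{0}" by (rule subring_submodule_0)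
  let ?g = "\<lambda>i j. Polynomial.monom (Polynomial.monom 1 i) j :: 'k poly poly"
  have g: "?g i j \<in> span_mod C {0} G" if "i < p" "j < p" for i j
    using that by (intro Z.span_mod_base) (auto simp: G_def)
  have ext: "w * t \<in> span_mod C {0} G" if t: "t \<in> span_mod C {0} G"
    and w: "\<And>i j. i < p \<Longrightarrow> j < p \<Longrightarrow> w * ?g i j \<in> span_mod C {0} G" for w t
  proof -
    from t obtain d where d: "\<forall>g\<in>G. d g \<in> C" "t = (\<Sum>g\<in>G. d g * g)" unfolding span_mod_def by auto
    have wG: "w * g \<in> span_mod C {0} G" if "g \<in> G" for g
    proof -
      from that obtain i j where "i < p" "j < p" "g = ?g i j" unfolding G_def by auto
      then show ?thesis using w by simp
    qed
    have "(\<Sum>g\<in>G. d g * (w * g)) \<in> span_mod C {0} G"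
      by (intro Z.span_mod_sum Z.span_mod_mult wG) (use d in blast)+
    then show ?thesis by (simp add: d(2) sum_distrib_left algebra_simps)
  qed
  have const: "cst c * t \<in> span_mod C {0} G" if "t \<in> span_mod C {0} G" for c t
    using that cst_C by (rule Z.span_mod_mult[rotated])
  have x: "[:[:0, 1:]:] * t \<in> span_mod C {0} G" if "t \<in> span_mod C {0} G" for t
  proof (rule ext[OF that])
    fix i j assume ij: "i < p" "j < p"
    have eq: "[:[:0, 1:]:] * ?g i j = ?g (Suc i) j" by (simp add: smult_monom monom_Suc)
    show "[:[:0, 1:]:] * ?g i j \<in> span_mod C {0} G"
    proof (cases "Suc i = p")
      case True
      \<comment> \<open>\<open>x^p\<close> is \<open>u\<close> and moves into the
        coefficient.\<close>
      then have "?g (Suc i) j = u * ?g 0 j" by (simp add: u_def smult_monom monom_0)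
      then show ?thesis unfolding eq using Z.span_mod_mult[OF u_C g[of 0 j]] ij by simp
    next
      case False
      then show ?thesis unfolding eq using ij by (intro g) auto
    qed
  qed
  have add: "s + t \<in> span_mod C {0} G" if "s \<in> span_mod C {0} G" "t \<in> span_mod C {0} G" for s t
    using that by (rule Z.span_mod_add)
  have zero: "0 \<in> span_mod C {0} G" by (rule Z.span_mod_J) simp
  have y: "[:0, 1:] * t \<in> span_mod C {0} G" if "t \<in> span_mod C {0} G" for t
  proof (rule ext[OF that])
    fix i j assume ij: "i < p" "j < p"
    have eq: "[:0, 1:] * ?g i j = ?g i (Suc j)" by (simp add: monom_Suc)
    show "[:0, 1:] * ?g i j \<in> span_mod C {0} G"
    proof (cases "Suc j = p")
      case True
      \<comment> \<open>\<open>y^p\<close> is \<open>z + r y\<close> with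
        \<open>r = delta_quot h p\<close>. The factor \<open>r\<close> is a polynomial in
        \<open>x\<close> and is absorbed by the closure under \<open>x\<close>; \<open>y^1\<close>
        is in range because \<open>p > 1\<close>.\<close>
      have "?g i p = z * ?g i 0 + [:delta_quot h p:] * ?g i 1"
        by (simp add: z_def left_diff_distrib mult_monom smult_monom)
      moreover have "z * ?g i 0 \<in> span_mod C {0} G"
        using ij by (intro Z.span_mod_mult[OF z_C] g) auto
      moreover have "[:delta_quot h p:] * ?g i 1 \<in> span_mod C {0} G"
        using zero add const x by (rule mult_coeff_closed) (use ij p_gt_1 in \<open>auto intro: g\<close>)
      ultimately show ?thesis unfolding eq True using add by metis
    next
      case False
      then show ?thesis unfolding eq using ij by (intro g) auto
    qed
  qed
  have "?g 0 0 = 1" by (simp add: monom_0 pCons_one)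
  then have one: "1 \<in> span_mod C {0} G" using g[of 0 0] p_pos by simp
  show ?thesis by (rule UNIV_if_closed[OF zero add const x y one])
qed

theorem maximal_invariant_finite_codim:
  assumes J: "invariant h J" and "1 \<notin> J"
    and maximal: "\<And>L. invariant h L \<Longrightarrow> J \<subseteq> L \<Longrightarrow> L = J \<or> L = UNIV"
  obtains W where "finite W" "\<And>t. t \<in> span_mod (range cst) J W"
proof -
  interpret S: subring_submodule C J
    using subring_submodule_0 invariant_0[OF J] invariant_add[OF J] invariant_C[OF J]
    by (simp add: subring_submodule_def)
  interpret simple_fg cst C J G
  proof
    show "finite G" by (simp add: G_def)
    have "Polynomial.monom (Polynomial.monom 1 0) 0 = (1 :: 'k poly poly)"
      by (simp add: monom_0 pCons_one)
    then show "1 \<in> G" using p_pos unfolding G_def by (intro image_eqI[of _ _ "(0, 0)"]) simp_all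
    show "t \<in> span_mod C J G" for t
      using span_G_0[of t] invariant_0[OF J] unfolding span_mod_def by auto
    show "1 \<notin> J" by fact
    show "c * t \<in> J" if c: "c \<in> C" "c \<in> J" for c t
    proof -
      \<comment> \<open>Schur's lemma, kernel: it contains 1 because \<open>c\<close> lies in
        \<open>J\<close>.\<close>
      let ?L = "{t. c * t \<in> J}"
      have "invariant h ?L"
        unfolding invariant_def
      proof (intro conjI ballI allI; unfold mem_Collect_eq)
        show "c * 0 \<in> J" using invariant_0[OF J] by simp
        show "c * (s + t) \<in> J" if "c * s \<in> J" "c * t \<in> J" for s t
          using invariant_add[OF J that] by (simp only: distrib_left)
        show "c * (cst d * t) \<in> J" if "c * t \<in> J" for d t
          using invariant_const[OF J that] by (simp only: mult.left_commute[of c])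
        show "c * ([:[:0, 1:]:] * t) \<in> J" if "c * t \<in> J" for t
          using invariant_x[OF J that] by (simp only: mult.left_commute[of c])
        show "c * y_op h t \<in> J" if "c * t \<in> J" for t
          using invariant_y[OF J that] by (simp only: y_op_C[OF c(1)])
      qed
      moreover have "J \<subseteq> ?L" using invariant_C[OF J c(1)] by blast
      moreover have "1 \<in> ?L" using c by simp
      ultimately have "?L = UNIV" using maximal \<open>1 \<notin> J\<close> by blast
      then show ?thesis by blast
    qed
    show "\<exists>t. w - c * t \<in> J" if c: "c \<in> C" "c \<notin> J" for c w
    proof -
      \<comment> \<open>Schur's lemma, image: this is \<open>J + c T\<close>, and it contains
        \<open>c\<close>, which is not in \<open>J\<close>.\<close>
      let ?L = "{w. \<exists>t. w - c * t \<in> J}"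
      have "invariant h ?L"
        unfolding invariant_def
      proof (intro conjI ballI allI; clarify)
        show "\<exists>t. 0 - c * t \<in> J" using invariant_0[OF J] by (intro exI[of _ 0]) simp
        show "\<exists>t. w + w' - c * t \<in> J" if "w - c * t \<in> J" "w' - c * t' \<in> J" for w w' t t'
          using invariant_add[OF J that] by (intro exI[of _ "t + t'"]) (simp add: algebra_simps)
        show "\<exists>t. cst d * w - c * t \<in> J" if "w - c * t \<in> J" for d w t
          using invariant_const[OF J that, of d]
          by (intro exI[of _ "cst d * t"])
            (simp only: right_diff_distrib mult.left_commute[of c])
        show "\<exists>t. [:[:0, 1:]:] * w - c * t \<in> J" if "w - c * t \<in> J" for w t
          using invariant_x[OF J that]
          by (intro exI[of _ "[:[:0, 1:]:] * t"])
            (simp only: right_diff_distrib mult.left_commute[of c])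
        show "\<exists>t. y_op h w - c * t \<in> J" if "w - c * t \<in> J" for w t
        proof -
          have "y_op h w = y_op h (w - c * t) + c * y_op h t"
            by (simp flip: y_op_C[OF c(1)] y_op_add)
          then show ?thesis using invariant_y[OF J that] by (intro exI[of _ "y_op h t"]) simp
        qed
      qed
      moreover have "J \<subseteq> ?L" by (auto intro: exI[of _ 0])
      moreover have "c \<in> ?L" using invariant_0[OF J] by (auto intro: exI[of _ 1])
      ultimately have "?L = UNIV" using maximal c by blast
      then show ?thesis by blast
    qed
  qed
  show ?thesis using finite_dim_mod_J[OF C_def] that by blast
qed

end

section \<open>From modules over the algebra to invariant subspaces\<close>

text \<open>The noncommutative counterpart of \<open>ev\<close>. Coefficients stand to the left of
  the powers of \<open>a\<close> and need not commute with them, so the recursion in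
  \<open>nc_ev_pCons\<close> splits off \<open>a\<close> on the right.\<close>

definition nc_ev :: "('c::comm_ring_1 \<Rightarrow> 'r::ring_1) \<Rightarrow> 'r \<Rightarrow> 'c poly \<Rightarrow> 'r"
  where "nc_ev \<kappa> a f = (\<Sum>i\<le>Polynomial.degree f. \<kappa> (Polynomial.coeff f i) * a ^ i)"

lemma nc_ev_altdef:
  assumes "\<kappa> 0 = 0" "Polynomial.degree f \<le> n"
  shows "nc_ev \<kappa> a f = (\<Sum>i\<le>n. \<kappa> (Polynomial.coeff f i) * a ^ i)"
  unfolding nc_ev_def using assms by (intro sum.mono_neutral_left) (auto simp: coeff_eq_0)

lemma nc_ev_0: "\<kappa> 0 = 0 \<Longrightarrow> nc_ev \<kappa> a 0 = 0"
  by (simp add: nc_ev_def)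

lemma nc_ev_pCons:
  assumes "\<kappa> 0 = 0"
  shows "nc_ev \<kappa> a (pCons c f) = \<kappa> c + nc_ev \<kappa> a f * a"
proof -
  have "nc_ev \<kappa> a (pCons c f) = (\<Sum>i\<le>Suc (Polynomial.degree f). \<kappa> (Polynomial.coeff (pCons c f) i) * a ^ i)"
    by (rule nc_ev_altdef[where \<kappa> = \<kappa>, OF assms degree_pCons_le])
  also have "\<dots> = \<kappa> c + nc_ev \<kappa> a f * a"
    by (subst sum.atMost_Suc_shift)
      (simp add: nc_ev_def sum_distrib_right power_Suc2 mult.assoc del: power_Suc)
  finally show ?thesis .
qed

lemma nc_ev_add:
  assumes "\<And>c d. \<kappa> (c + d) = \<kappa> c + \<kappa> d"
  shows "nc_ev \<kappa> a (f + g) = nc_ev \<kappa> a f + nc_ev \<kappa> a g"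
proof -
  have zero: "\<kappa> 0 = 0" using assms[of 0 0] by simp
  define n where "n = max (Polynomial.degree f) (Polynomial.degree g)"
  have "Polynomial.degree (f + g) \<le> n" "Polynomial.degree f \<le> n" "Polynomial.degree g \<le> n"
    by (auto simp: n_def intro: degree_add_le)
  then show ?thesis
    by (simp add: nc_ev_altdef[where \<kappa> = \<kappa>, OF zero, of _ n] assms distrib_right sum.distrib)
qed

section \<open>The free algebra and normally ordered elements\<close>

lemma scalar_0: "scalar 0 = 0"
  by (simp add: scalar_def)

lemma scalar_1: "scalar 1 = 1"
  by (simp add: scalar_def)

lemma scalar_add: "scalar (c + d) = scalar c + scalar d"
  by (simp add: scalar_def single_add)

lemma scalar_mult: "scalar (c * d) = scalar c * scalar d"
  by (simp add: scalar_def mult_single)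

text \<open>Words grow on the left, as suits a left module: by \<open>act_mult\<close> the new
  letter acts last.\<close>

lemma free_algebra_induct [case_names scalar gen add]:
  assumes scalar: "\<And>c. P (scalar c)" and gen: "\<And>x a. P a \<Longrightarrow> P (gen x * a)"
    and add: "\<And>a b. P a \<Longrightarrow> P b \<Longrightarrow> P (a + b)"
  shows "P a"
proof (induction a rule: update_induct)
  case const
  show ?case using scalar[of 0] by (simp add: scalar_0)
next
  case (update f w c)
  have single: "P (Poly_Mapping.single (Word ws) c)" for ws
  proof (induction ws)
    case Nil
    show ?case using scalar[of c] by (simp add: scalar_def zero_free_monoid_def)
  next
    case (Cons x ws)
    have "Poly_Mapping.single (Word (x # ws)) c = gen x * Poly_Mapping.single (Word ws) c"
      by (simp add: gen_def mult_single plus_free_monoid_def)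
    then show ?case using gen[OF Cons.IH] by simp
  qed
  have "Poly_Mapping.update w c f = f + Poly_Mapping.single w c"
    using update.hyps
    by (intro poly_mapping_eqI) (auto simp: lookup_update lookup_add lookup_single in_keys_iff when_def)
  then show ?case using add[OF update.IH single[of "letters w"]] by simp
qed

lemma scalar_commute: "scalar c * a = a * scalar c"
proof (induction a rule: free_algebra_induct)
  case (scalar d)
  then show ?case by (simp flip: scalar_mult add: mult.commute)
next
  case (gen x a)
  have "scalar c * gen x = gen x * scalar c"
    by (simp add: scalar_def gen_def mult_single)
  then show ?case using gen by (metis mult.assoc)
next
  case (add a b)
  then show ?case by (simp add: distrib_left distrib_right)
qed

abbreviation poly_X :: "'k::field poly \<Rightarrow> (xy, 'k) free_algebra"
  where "poly_X f \<equiv> poly_at f (gen X)"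

lemma poly_at_eq_nc_ev: "poly_at f a = nc_ev scalar a f"
  by (simp add: poly_at_def nc_ev_def)

lemma poly_X_0: "poly_X 0 = 0"
  by (simp add: poly_at_eq_nc_ev nc_ev_0 scalar_0)

lemma poly_X_pCons: "poly_X (pCons c f) = scalar c + poly_X f * gen X"
  by (simp add: poly_at_eq_nc_ev nc_ev_pCons scalar_0)

lemma poly_X_add: "poly_X (f + g) = poly_X f + poly_X g"
  by (simp add: poly_at_eq_nc_ev nc_ev_add scalar_add)

lemma poly_X_commute: "poly_X f * gen X = gen X * poly_X f"
proof (induction f)
  case (pCons c f)
  have "poly_X (pCons c f) * gen X = scalar c * gen X + gen X * poly_X f * gen X"
    by (simp add: poly_X_pCons distrib_right pCons.IH)
  then show ?case by (simp add: poly_X_pCons distrib_left scalar_commute mult.assoc)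
qed (simp add: poly_X_0)

lemma poly_X_smult: "poly_X (Polynomial.smult c f) = scalar c * poly_X f"
  by (induction f) (simp_all add: poly_X_0 poly_X_pCons scalar_mult distrib_left mult.assoc)

lemma poly_X_mult: "poly_X (f * g) = poly_X f * poly_X g"
proof (induction f)
  case (pCons c f)
  have "poly_X (pCons c f * g) = scalar c * poly_X g + poly_X f * (poly_X g * gen X)"
    by (simp add: poly_X_add poly_X_smult poly_X_pCons scalar_0 pCons.IH mult.assoc)
  then show ?case by (simp add: poly_X_commute[of g] poly_X_pCons distrib_right mult.assoc)
qed (simp add: poly_X_0)

text \<open>A lift of \<open>F[x][y]\<close> to words with \<open>X\<close> before \<open>Y\<close>.
  It is additive but not multiplicative; the relation enters only through the action on a
  module.\<close>

definition normal_ord :: "'k::field poly poly \<Rightarrow> (xy, 'k) free_algebra"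
  where "normal_ord = nc_ev poly_X (gen Y)"

lemma normal_ord_0: "normal_ord 0 = 0"
  by (simp add: normal_ord_def nc_ev_0 poly_X_0)

lemma normal_ord_pCons: "normal_ord (pCons f t) = poly_X f + normal_ord t * gen Y"
  by (simp add: normal_ord_def nc_ev_pCons poly_X_0)

lemma normal_ord_add: "normal_ord (s + t) = normal_ord s + normal_ord t"
  by (simp add: normal_ord_def nc_ev_add poly_X_add)

lemma normal_ord_smult: "normal_ord (Polynomial.smult f t) = poly_X f * normal_ord t"
  by (induction t) (simp_all add: normal_ord_0 normal_ord_pCons poly_X_mult distrib_left mult.assoc)

section \<open>The action on a module and the orbit map of a vector\<close>

locale A_module = left_module "A_alg h" M
  for h :: "'k::field poly" and M :: "((xy, 'k) free_algebra set, 'v) module"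
begin

definition act :: "(xy, 'k) free_algebra \<Rightarrow> 'v \<Rightarrow> 'v"
  where "act a v = A_proj h a \<odot>\<^bsub>M\<^esub> v"

lemma proj_closed: "A_proj h a \<in> carrier (A_alg h)"
  using ring_hom_closed[OF A_proj_hom, of a h] by simp

lemma act_closed [simp]: "v \<in> carrier M \<Longrightarrow> act a v \<in> carrier M"
  by (simp add: act_def proj_closed)

lemma act_add: "v \<in> carrier M \<Longrightarrow> act (a + b) v = act a v \<oplus>\<^bsub>M\<^esub> act b v"
  using ring_hom_add[OF A_proj_hom, of a b h] by (simp add: act_def smult_l_distr proj_closed)

lemma act_add_right: "v \<in> carrier M \<Longrightarrow> w \<in> carrier M \<Longrightarrow> act a (v \<oplus>\<^bsub>M\<^esub> w) = act a v \<oplus>\<^bsub>M\<^esub> act a w"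
  by (simp add: act_def smult_r_distr proj_closed)

lemma act_mult: "v \<in> carrier M \<Longrightarrow> act (a * b) v = act a (act b v)"
  using ring_hom_mult[OF A_proj_hom, of a b h] by (simp add: act_def smult_assoc proj_closed)

lemma act_1: "v \<in> carrier M \<Longrightarrow> act 1 v = v"
  using ring_hom_one[OF A_proj_hom, of h] by (simp add: act_def)

lemma act_0: "v \<in> carrier M \<Longrightarrow> act 0 v = \<zero>\<^bsub>M\<^esub>"
  using act_add[of v 0 0] by simp

lemma act_zero: "act a \<zero>\<^bsub>M\<^esub> = \<zero>\<^bsub>M\<^esub>"
  using act_add_right[of "\<zero>\<^bsub>M\<^esub>" "\<zero>\<^bsub>M\<^esub>" a] by simp

lemma act_relation:
  "v \<in> carrier M \<Longrightarrow> act (gen Y) (act (gen X) v) = act (gen X) (act (gen Y) v) \<oplus>\<^bsub>M\<^esub> act (poly_X h) v"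
  using arg_cong[OF A_relation[of h], of "\<lambda>a. a \<odot>\<^bsub>M\<^esub> v"]
  by (simp add: act_def smult_l_distr smult_assoc proj_closed)

text \<open>The defining relation is the case \<open>f = x\<close>, and the Leibniz rule carries it
  along \<open>pCons\<close>. The induction hypothesis is used at \<open>X v\<close>, hence
  \<open>v\<close> stays arbitrary.\<close>

lemma act_Y_poly_X:
  assumes "v \<in> carrier M"
  shows "act (gen Y) (act (poly_X f) v) = act (poly_X f) (act (gen Y) v) \<oplus>\<^bsub>M\<^esub> act (poly_X (delta h f)) v"
  using assms
proof (induction f arbitrary: v)
  case 0
  then show ?case by (simp add: poly_X_0 act_0 act_zero)
next
  case (pCons c f)
  let ?X = "act (gen X)" and ?Y = "act (gen Y)" and ?s = "act (scalar c)"
  note [simp] = pCons.prems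
  have YX: "?Y (?X v) = ?X (?Y v) \<oplus>\<^bsub>M\<^esub> act (poly_X h) v" by (rule act_relation) simp
  have sY: "?Y (?s v) = ?s (?Y v)" by (simp flip: act_mult add: scalar_commute)
  have "delta h (pCons c f) = f * h + pCons 0 (delta h f)"
    by (simp add: delta_def pderiv_pCons algebra_simps)
  then have d: "act (poly_X (delta h (pCons c f))) v = act (poly_X f) (act (poly_X h) v) \<oplus>\<^bsub>M\<^esub> act (poly_X (delta h f)) (?X v)"
    by (simp add: poly_X_add poly_X_mult poly_X_pCons scalar_0 act_add act_mult)
  have "?Y (act (poly_X (pCons c f)) v) = ?s (?Y v) \<oplus>\<^bsub>M\<^esub> ?Y (act (poly_X f) (?X v))"
    by (simp add: poly_X_pCons act_add act_mult act_add_right sY)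
  also have "?Y (act (poly_X f) (?X v)) = act (poly_X f) (?X (?Y v)) \<oplus>\<^bsub>M\<^esub> act (poly_X f) (act (poly_X h) v) \<oplus>\<^bsub>M\<^esub> act (poly_X (delta h f)) (?X v)"
    by (simp add: pCons.IH YX act_add_right)
  finally show ?case unfolding d by (simp add: poly_X_pCons act_add act_mult M.a_assoc)
qed

definition orbit_map :: "'v \<Rightarrow> 'k poly poly \<Rightarrow> 'v"
  where "orbit_map v t = act (normal_ord t) v"

lemma orbit_map_closed [simp]: "v \<in> carrier M \<Longrightarrow> orbit_map v t \<in> carrier M"
  by (simp add: orbit_map_def)

lemma orbit_map_0: "v \<in> carrier M \<Longrightarrow> orbit_map v 0 = \<zero>\<^bsub>M\<^esub>"
  by (simp add: orbit_map_def normal_ord_0 act_0)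

lemma orbit_map_add: "v \<in> carrier M \<Longrightarrow> orbit_map v (s + t) = orbit_map v s \<oplus>\<^bsub>M\<^esub> orbit_map v t"
  by (simp add: orbit_map_def normal_ord_add act_add)

lemma orbit_map_smult: "v \<in> carrier M \<Longrightarrow> orbit_map v ([:f:] * t) = act (poly_X f) (orbit_map v t)"
  by (simp add: orbit_map_def normal_ord_smult act_mult)

lemma orbit_map_const: "v \<in> carrier M \<Longrightarrow> orbit_map v ([:[:c:]:] * t) = act (scalar c) (orbit_map v t)"
  by (simp only: orbit_map_smult poly_X_pCons poly_X_0) simp

lemma orbit_map_X: "v \<in> carrier M \<Longrightarrow> orbit_map v ([:[:0, 1:]:] * t) = act (gen X) (orbit_map v t)"
  by (simp only: orbit_map_smult poly_X_pCons poly_X_0) (simp add: scalar_0 scalar_1)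

lemma orbit_map_1: "v \<in> carrier M \<Longrightarrow> orbit_map v 1 = v"
proof -
  have "normal_ord [:[:1 :: 'k:]:] = 1" by (simp only: normal_ord_pCons normal_ord_0 poly_X_pCons poly_X_0) (simp add: scalar_1)
  then show "v \<in> carrier M \<Longrightarrow> orbit_map v 1 = v" by (simp add: orbit_map_def act_1 pCons_one)
qed

lemma orbit_map_pCons: "v \<in> carrier M \<Longrightarrow> orbit_map v (pCons f t) = act (poly_X f) v \<oplus>\<^bsub>M\<^esub> orbit_map (act (gen Y) v) t"
  by (simp add: orbit_map_def normal_ord_pCons act_add act_mult)

text \<open>With \<open>orbit_map_const\<close> and \<open>orbit_map_X\<close> this makes
  \<open>orbit_map v\<close> compatible with the whole action. Peeling off \<open>pCons\<close>
  splits a \<open>Y\<close> off on the right, so the induction passes from \<open>v\<close> to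
  \<open>Y v\<close>.\<close>

lemma orbit_map_y_op: "v \<in> carrier M \<Longrightarrow> orbit_map v (y_op h t) = act (gen Y) (orbit_map v t)"
proof (induction t arbitrary: v)
  case 0
  then show ?case by (simp add: orbit_map_0 act_zero)
next
  case (pCons f t)
  note [simp] = pCons.prems
  have "pCons f 0 = [:f:]" by simp
  have "orbit_map v (y_op h (pCons f t)) = act (poly_X (delta h f)) v \<oplus>\<^bsub>M\<^esub> (orbit_map (act (gen Y) v) [:f:] \<oplus>\<^bsub>M\<^esub> orbit_map (act (gen Y) v) (y_op h t))"
    by (simp only: y_op_pCons orbit_map_pCons[OF pCons.prems] orbit_map_add[OF act_closed[OF pCons.prems]])
  also have "orbit_map (act (gen Y) v) [:f:] = act (poly_X f) (act (gen Y) v)"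
    by (simp add: orbit_map_pCons orbit_map_0)
  also have "orbit_map (act (gen Y) v) (y_op h t) = act (gen Y) (orbit_map (act (gen Y) v) t)"
    by (rule pCons.IH) simp
  finally show ?case by (simp add: orbit_map_pCons act_add_right act_Y_poly_X M.a_ac)
qed

text \<open>Every element of the algebra is the class of an element of the free algebra, so
  stability under scalars and generators is enough; negatives come from the action of -1.\<close>

lemma submodule_closed:
  assumes "N \<subseteq> carrier M" "\<zero>\<^bsub>M\<^esub> \<in> N" "\<And>v w. v \<in> N \<Longrightarrow> w \<in> N \<Longrightarrow> v \<oplus>\<^bsub>M\<^esub> w \<in> N"
    and "\<And>c v. v \<in> N \<Longrightarrow> act (scalar c) v \<in> N"
    and "\<And>x v. v \<in> N \<Longrightarrow> act (gen x) v \<in> N"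
  shows "Module.submodule N (A_alg h) M"
proof -
  have act: "act a v \<in> N" if "v \<in> N" for a v
    using that
  proof (induction a rule: free_algebra_induct)
    case (gen x a)
    then show ?case using assms(1,5) by (simp add: act_mult subset_iff)
  next
    case (add a b)
    then show ?case using assms(1,3) by (simp add: act_add subset_iff)
  qed (rule assms)
  have "\<ominus>\<^bsub>M\<^esub> v \<in> N" if "v \<in> N" for v
  proof -
    have v: "v \<in> carrier M" using that assms(1) by blast
    have "act (-1) v \<oplus>\<^bsub>M\<^esub> v = \<zero>\<^bsub>M\<^esub>"
      using act_add[OF v, of "-1" 1] by (simp add: act_1 act_0 v)
    then have "\<ominus>\<^bsub>M\<^esub> v = act (-1) v" using v by (intro M.minus_equality) auto
    then show ?thesis using act[OF that] by simp
  qed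
  moreover have "\<exists>b. a = A_proj h b" if "a \<in> carrier (A_alg h)" for a
    using that unfolding A_alg_def A_proj_def FactRing_def A_RCOSETS_def' by auto
  then have "a \<odot>\<^bsub>M\<^esub> v \<in> N" if "a \<in> carrier (A_alg h)" "v \<in> N" for a v
    using act that unfolding act_def by blast
  ultimately show ?thesis
    using assms(1-3)
    by (intro Module.submodule.intro subgroup.intro submodule_axioms.intro)
      (auto simp: a_inv_def)
qed

end

section \<open>Irreducible modules as quotients by maximal invariant subspaces\<close>

theorem proposition1p7:
  fixes h :: "'k::field poly"
    and p :: nat
    and M :: "((xy, 'k) free_algebra set, 'v) module"
  assumes "CHAR('k) = p" and "p > 0"
    and "h \<noteq> 0"
    and "irreducible_module (A_alg h) M"
  shows "vectorspace.fin_dim class_ring (A_vs h M)"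
proof -
  from assms(4) have lm: "left_module (A_alg h) M" and nz: "carrier M \<noteq> {\<zero>\<^bsub>M\<^esub>}"
    and irr: "\<And>N. Module.submodule N (A_alg h) M \<Longrightarrow> N = {\<zero>\<^bsub>M\<^esub>} \<or> N = carrier M"
    unfolding irreducible_module_def by blast+
  interpret A_module h M unfolding A_module_def by (rule lm)
  interpret weyl_char h p by standard (use assms in auto)
  obtain v where v [simp]: "v \<in> carrier M" and "v \<noteq> \<zero>\<^bsub>M\<^esub>"
    using nz M.zero_closed by blast
  \<comment> \<open>Invariant subspaces are carried to submodules, so irreducibility leaves two
    possible images.\<close>
  have image: "orbit_map v ` L = {\<zero>\<^bsub>M\<^esub>} \<or> orbit_map v ` L = carrier M" if L: "invariant h L" for L
  proof (rule irr[OF submodule_closed])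
    show "orbit_map v ` L \<subseteq> carrier M" by auto
    show "\<zero>\<^bsub>M\<^esub> \<in> orbit_map v ` L" using orbit_map_0[OF v] invariant_0[OF L] by (metis imageI)
    show "w \<oplus>\<^bsub>M\<^esub> w' \<in> orbit_map v ` L" if "w \<in> orbit_map v ` L" "w' \<in> orbit_map v ` L" for w w'
      using that invariant_add[OF L] by (auto simp flip: orbit_map_add)
    show "act (scalar c) w \<in> orbit_map v ` L" if "w \<in> orbit_map v ` L" for c w
      using that invariant_const[OF L] by (auto simp only: orbit_map_const[OF v, symmetric])
    show "act (gen x) w \<in> orbit_map v ` L" if "w \<in> orbit_map v ` L" for x w
      using that invariant_x[OF L] invariant_y[OF L]
      by (cases x) (auto simp only: orbit_map_X[OF v, symmetric] orbit_map_y_op[OF v, symmetric])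
  qed
  have "v \<in> range (orbit_map v)" using orbit_map_1[OF v] by (metis rangeI)
  then have "range (orbit_map v) \<noteq> {\<zero>\<^bsub>M\<^esub>}" using \<open>v \<noteq> \<zero>\<^bsub>M\<^esub>\<close> by blast
  moreover have "invariant h (UNIV :: 'k poly poly set)" by (simp add: invariant_def)
  ultimately have surj: "range (orbit_map v) = carrier M" using image by blast
  define J where "J = {t. orbit_map v t = \<zero>\<^bsub>M\<^esub>}"
  have J: "invariant h J"
    unfolding invariant_def J_def mem_Collect_eq
    by (auto simp only: orbit_map_0 orbit_map_add orbit_map_const orbit_map_X orbit_map_y_op v act_zero ball_simps mem_Collect_eq M.l_zero M.zero_closed)
  have "1 \<notin> J" using \<open>v \<noteq> \<zero>\<^bsub>M\<^esub>\<close> by (simp add: J_def orbit_map_1)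
  \<comment> \<open>If \<open>L\<close> maps onto \<open>M\<close>, every \<open>t\<close> differs
    from an element of \<open>L\<close> by an element of the kernel \<open>J\<close>, which
    \<open>L\<close> contains; otherwise \<open>L\<close> maps to zero and lies in
    \<open>J\<close>.\<close>
  have maximal: "L = J \<or> L = UNIV" if L: "invariant h L" and "J \<subseteq> L" for L
  proof (cases "orbit_map v ` L = carrier M")
    case True
    have "t \<in> L" for t
    proof -
      have "orbit_map v t \<in> orbit_map v ` L" using True by simp
      then obtain l where l: "l \<in> L" "orbit_map v t = orbit_map v l" by blast
      have "orbit_map v (t - l) \<oplus>\<^bsub>M\<^esub> orbit_map v l = \<zero>\<^bsub>M\<^esub> \<oplus>\<^bsub>M\<^esub> orbit_map v l"
        using orbit_map_add[OF v, of "t - l" l] l by simp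
      then have "t - l \<in> L" using \<open>J \<subseteq> L\<close> by (auto simp: J_def)
      then show "t \<in> L" using invariant_add[OF L _ l(1), of "t - l"] by simp
    qed
    then show ?thesis by blast
  next
    case False
    then have "L \<subseteq> J" using image[OF L] unfolding J_def by blast
    then show ?thesis using \<open>J \<subseteq> L\<close> by blast
  qed
  obtain W where W: "finite W" "\<And>t. t \<in> span_mod (range cst) J W"
    using maximal_invariant_finite_codim[OF J \<open>1 \<notin> J\<close> maximal] by blast
  interpret V: vectorspace class_ring "A_vs h M" by (rule vectorspace_A_vs[OF lm])
  have carrier: "carrier (A_vs h M) = carrier M" and add: "add (A_vs h M) = add M"
    and zero: "zero (A_vs h M) = zero M" and smult: "smult (A_vs h M) c w = act (scalar c) w" for c w
    by (simp_all add: A_vs_def restrict_scalars_def act_def A_scalar_def)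
  have PW: "orbit_map v ` W \<subseteq> carrier (A_vs h M)" by (auto simp: carrier)
  note span = V.span_is_submodule[OF PW]
  note span_add = LinearCombinations.submodule.m_closed[OF span]
    and span_zero = LinearCombinations.submodule.zero_closed[OF span]
    and span_smult = LinearCombinations.submodule.smult_closed[OF span]
  have "w \<in> V.span (orbit_map v ` W)" if "w \<in> carrier M" for w
  proof -
    from that have "w \<in> range (orbit_map v)" by (simp only: surj)
    then obtain t where t: "w = orbit_map v t" by (rule imageE)
    from W(2)[of t] obtain d where d: "\<forall>g\<in>W. d g \<in> range cst" "t - (\<Sum>g\<in>W. d g * g) \<in> J"
      unfolding span_mod_def mem_Collect_eq by (elim exE conjE)
    \<comment> \<open>The induction over subsets of \<open>W\<close> is there because
      \<open>orbit_map v\<close> may identify elements of \<open>W\<close>, so \<open>d\<close> does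
      not directly give coefficients on the image.\<close>
    have "orbit_map v (\<Sum>g\<in>U. d g * g) \<in> V.span (orbit_map v ` W)" if "finite U" "U \<subseteq> W" for U
      using that
    proof (induction U rule: finite_induct)
      case empty
      then show ?case using span_zero by (simp add: orbit_map_0 zero)
    next
      case (insert g U)
      then have "d g \<in> range cst" using d(1) by simp
      then obtain c where c: "d g = cst c" by (rule imageE)
      have "orbit_map v g \<in> V.span (orbit_map v ` W)" using subsetD[OF V.in_own_span[OF PW]] insert.prems by simp
      then have "act (scalar c) (orbit_map v g) \<in> V.span (orbit_map v ` W)"
        using span_smult[of c "orbit_map v g"] by (simp add: smult)
      then have "act (scalar c) (orbit_map v g) \<oplus>\<^bsub>M\<^esub> orbit_map v (\<Sum>g\<in>U. d g * g) \<in> V.span (orbit_map v ` W)"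
        using span_add insert by (simp add: add)
      then show ?case by (simp only: sum.insert[OF insert.hyps] orbit_map_add[OF v] c orbit_map_const[OF v])
    qed
    from this[OF W(1) subset_refl] have "orbit_map v (\<Sum>g\<in>W. d g * g) \<in> V.span (orbit_map v ` W)" .
    moreover have "orbit_map v t = orbit_map v (t - (\<Sum>g\<in>W. d g * g)) \<oplus>\<^bsub>M\<^esub> orbit_map v (\<Sum>g\<in>W. d g * g)"
      by (simp flip: orbit_map_add)
    ultimately show ?thesis using d(2) by (simp add: t J_def)
  qed
  then have "V.span (orbit_map v ` W) = carrier (A_vs h M)"
    using V.span_is_subset2[OF PW] by (auto simp: carrier)
  then show ?thesis
    unfolding V.fin_dim_def using W(1) PW by blast
qed

end
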